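(* Let $K$ be a field, $S=K[x_1,\ldots,x_n]$ the polynomial ring in $n\geq 2$ variables, and let $I,J\subset S$ be monomial ideals of height $n$. Then $\operatorname{type}(S/IJ)\geq 3$ if either $n\geq 3$, or else $n=2$ and $\max\{\mu(I),\mu(J)\}\geq 3$.
   Context: $\mu(L)$ denotes the minimal number of generators of a monomial ideal $L$. For a graded Cohen–Macaulay $S$-module $M$ of dimension $d$, the Cohen–Macaulay type $\operatorname{type}(M)$ is the $K$-vector space dimension of $\operatorname{Ext}^d_S(K,M)$, where $K=S/(x_1,\ldots,x_n)$; equivalently, it is the rank of the last free module in the minimal graded free $S$-resolution of $M$. *)

theory Defs
  imports
    "HOL-Library.Poly_Mapping"
    "HOL-Library.Extended_Nat"
    "HOL-Library.Cardinality"
    "HOL-Algebra.Ideal_Product"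
    "HOL-Algebra.Algebraic_Closure_Type"
    "Jordan_Normal_Form.Missing_VectorSpace"
begin

hide_const (open) Multiset.mult Polynomial.smult

section \<open>Height and Krull dimension\<close>

definition prime_chain :: "('a, 'm) ring_scheme \<Rightarrow> nat \<Rightarrow> (nat \<Rightarrow> 'a set) \<Rightarrow> bool" where
  "prime_chain R k P \<longleftrightarrow> (\<forall>i\<le>k. primeideal (P i) R) \<and> (\<forall>i<k. P i \<subset> P (Suc i))"

definition prime_height :: "('a, 'm) ring_scheme \<Rightarrow> 'a set \<Rightarrow> enat" where
  "prime_height R Q = Sup {enat k | k. \<exists>P. prime_chain R k P \<and> P k = Q}"

text \<open>The unit ideal lies in no prime ideal, so it has height \<open>\<infinity>\<close>.\<close>

definition ideal_height :: "('a, 'm) ring_scheme \<Rightarrow> 'a set \<Rightarrow> enat" where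
  "ideal_height R I = Inf {prime_height R Q | Q. primeideal Q R \<and> I \<subseteq> Q}"

definition annihilator :: "('a, 'm) ring_scheme \<Rightarrow> ('a, 'b, 'c) module_scheme \<Rightarrow> 'a set" where
  "annihilator R M = {r \<in> carrier R. \<forall>x \<in> carrier M. r \<odot>\<^bsub>M\<^esub> x = \<zero>\<^bsub>M\<^esub>}"

definition module_krull_dim :: "('a, 'm) ring_scheme \<Rightarrow> ('a, 'b, 'c) module_scheme \<Rightarrow> enat" where
  "module_krull_dim R M = Sup {enat k | k. \<exists>P. prime_chain R k P \<and> annihilator R M \<subseteq> P 0}"


section \<open>Modules\<close>

text \<open>
  A \<^type>\<open>module\<close> record inherits the fields \<open>mult\<close> and \<open>one\<close> from rings; they are irrelevant for
  modules and left undefined.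
\<close>

definition regular_module :: "('a, 'm) ring_scheme \<Rightarrow> ('a, 'a) module" where
  "regular_module R = \<lparr>carrier = carrier R, mult = undefined, one = undefined,
     zero = \<zero>\<^bsub>R\<^esub>, add = add R, smult = mult R\<rparr>"

text \<open>
  The quotient \<open>M / W\<close> by a submodule \<open>W\<close>. As for \<^const>\<open>rcoset_mult\<close>, the scalar multiple
  \<open>r \<cdot> (W + x) = W + r x\<close> is written as a union over all representatives of the coset.
\<close>

definition quot_module :: "('a, 'b, 'c) module_scheme \<Rightarrow> 'b set \<Rightarrow> ('a, 'b set) module" where
  "quot_module M W = \<lparr>carrier = a_rcosets\<^bsub>M\<^esub> W, mult = undefined, one = undefined,
     zero = W, add = set_add M, smult = (\<lambda>r C. \<Union>x\<in>C. W +>\<^bsub>M\<^esub> (r \<odot>\<^bsub>M\<^esub> x))\<rparr>"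

text \<open>Homomorphisms are taken extensional, so that they are determined by their values on \<open>M\<close>.\<close>

definition hom_module ::
  "('a, 'm) ring_scheme \<Rightarrow> ('a, 'b, 'c) module_scheme \<Rightarrow> ('a, 'd, 'e) module_scheme
    \<Rightarrow> ('a, 'b \<Rightarrow> 'd) module" where
  "hom_module R M N = \<lparr>carrier = module_hom R M N \<inter> extensional (carrier M),
     mult = undefined, one = undefined,
     zero = (\<lambda>x\<in>carrier M. \<zero>\<^bsub>N\<^esub>),
     add = (\<lambda>f g. \<lambda>x\<in>carrier M. f x \<oplus>\<^bsub>N\<^esub> g x),
     smult = (\<lambda>r f. \<lambda>x\<in>carrier M. r \<odot>\<^bsub>N\<^esub> f x)\<rparr>"

definition restrict_scalars :: "('k \<Rightarrow> 'a) \<Rightarrow> ('a, 'b, 'c) module_scheme \<Rightarrow> ('k, 'b) module" where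
  "restrict_scalars \<phi> M = \<lparr>carrier = carrier M, mult = undefined, one = undefined,
     zero = \<zero>\<^bsub>M\<^esub>, add = add M, smult = (\<lambda>c x. \<phi> c \<odot>\<^bsub>M\<^esub> x)\<rparr>"

definition free_module :: "('a, 'm) ring_scheme \<Rightarrow> ('a, 'b, 'c) module_scheme \<Rightarrow> bool" where
  "free_module R F \<longleftrightarrow> module R F \<and>
     (\<exists>B \<subseteq> carrier F. \<not> module.lin_dep R F B \<and> module.span R F B = carrier F)"


section \<open>Ext\<close>

text \<open>Exactness of \<open>\<dots> \<rightarrow> F 2 \<rightarrow> F 1 \<rightarrow> F 0 \<rightarrow> N \<rightarrow> 0\<close>, where \<open>d i : F (i + 1) \<rightarrow> F i\<close> and \<open>\<epsilon> : F 0 \<rightarrow> N\<close>.\<close>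

definition free_resolution ::
  "('a, 'm) ring_scheme \<Rightarrow> ('a, 'b, 'c) module_scheme \<Rightarrow> (nat \<Rightarrow> ('a, 'f) module)
    \<Rightarrow> (nat \<Rightarrow> 'f \<Rightarrow> 'f) \<Rightarrow> ('f \<Rightarrow> 'b) \<Rightarrow> bool" where
  "free_resolution R N F d \<epsilon> \<longleftrightarrow>
     (\<forall>i. free_module R (F i)) \<and>
     (\<forall>i. d i \<in> module_hom R (F (Suc i)) (F i)) \<and>
     \<epsilon> \<in> module_hom R (F 0) N \<and>
     \<epsilon> ` carrier (F 0) = carrier N \<and>
     {x \<in> carrier (F 0). \<epsilon> x = \<zero>\<^bsub>N\<^esub>} = d 0 ` carrier (F 1) \<and>
     (\<forall>i. {x \<in> carrier (F (Suc i)). d i x = \<zero>\<^bsub>F i\<^esub>} = d (Suc i) ` carrier (F (Suc (Suc i))))"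

text \<open>The \<open>i\<close>-th cohomology of the complex \<open>Hom(F 0, M) \<rightarrow> Hom(F 1, M) \<rightarrow> \<dots>\<close>.\<close>

definition hom_cohomology ::
  "('a, 'm) ring_scheme \<Rightarrow> (nat \<Rightarrow> ('a, 'f) module) \<Rightarrow> (nat \<Rightarrow> 'f \<Rightarrow> 'f)
    \<Rightarrow> ('a, 'b, 'c) module_scheme \<Rightarrow> nat \<Rightarrow> ('a, ('f \<Rightarrow> 'b) set) module" where
  "hom_cohomology R F d M i =
     (let H = (\<lambda>j. hom_module R (F j) M);
          \<delta> = (\<lambda>j f. \<lambda>x\<in>carrier (F (Suc j)). f (d j x));
          Z = {f \<in> carrier (H i). \<delta> i f = \<zero>\<^bsub>H (Suc i)\<^esub>};
          B = (case i of 0 \<Rightarrow> {\<zero>\<^bsub>H 0\<^esub>} | Suc j \<Rightarrow> \<delta> j ` carrier (H j))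
      in quot_module ((H i)\<lparr>carrier := Z\<rparr>) B)"

text \<open>
  \<open>Ext\<^sup>i\<^sub>R(N, M)\<close>, computed from an arbitrarily chosen free resolution of \<open>N\<close>; up to isomorphism
  it does not depend on the choice. The carriers of the free modules are taken in the type
  \<^typ>\<open>nat \<Rightarrow>\<^sub>0 'a\<close>, which has room for free modules of countable rank; thus a resolution exists for
  every finitely generated module over a noetherian ring.
\<close>

definition ext_module ::
  "('a::zero, 'm) ring_scheme \<Rightarrow> nat \<Rightarrow> ('a, 'b, 'c) module_scheme \<Rightarrow> ('a, 'd, 'e) module_scheme
    \<Rightarrow> ('a, ((nat \<Rightarrow>\<^sub>0 'a) \<Rightarrow> 'd) set) module" where
  "ext_module R i N M =
     (case (SOME (F, d, \<epsilon>). free_resolution R N F d \<epsilon>) of (F, d, \<epsilon>) \<Rightarrow> hom_cohomology R F d M i)"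


section \<open>Polynomial rings and monomial ideals\<close>

text \<open>
  \<open>K[x\<^sub>1, \<dots>, x\<^sub>n]\<close> with coefficient field \<^typ>\<open>'k\<close> and variables indexed by the finite type \<^typ>\<open>'n\<close>:
  a polynomial maps exponent vectors to coefficients, with finite support.
\<close>

type_synonym ('n, 'k) mpol = "('n \<Rightarrow>\<^sub>0 nat) \<Rightarrow>\<^sub>0 'k"

abbreviation mpol_ring :: "('n::finite, 'k::field) mpol ring" where
  "mpol_ring \<equiv> ring_of_type_algebra"

definition monomial :: "('n \<Rightarrow>\<^sub>0 nat) \<Rightarrow> ('n::finite, 'k::field) mpol" where
  "monomial a = Poly_Mapping.single a 1"

definition var :: "'n \<Rightarrow> ('n::finite, 'k::field) mpol" where
  "var i = monomial (Poly_Mapping.single i 1)"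

definition const :: "'k \<Rightarrow> ('n::finite, 'k::field) mpol" where
  "const c = Poly_Mapping.single 0 c"

definition monomial_ideal :: "('n::finite, 'k::field) mpol set \<Rightarrow> bool" where
  "monomial_ideal I \<longleftrightarrow> (\<exists>A \<subseteq> range monomial. I = genideal mpol_ring A)"

definition min_gens :: "('n::finite, 'k::field) mpol set \<Rightarrow> nat" where
  "min_gens I = (LEAST k. \<exists>A. finite A \<and> card A = k \<and> I = genideal mpol_ring A)"

definition quot_by_ideal ::
  "('n::finite, 'k::field) mpol set \<Rightarrow> (('n, 'k) mpol, ('n, 'k) mpol set) module" where
  "quot_by_ideal L = quot_module (regular_module mpol_ring) L"


section \<open>Cohen--Macaulay type\<close>

text \<open>
  \<open>dim\<^sub>K Ext\<^sup>d\<^sub>S(K, M)\<close> for \<open>S = K[x\<^sub>1, \<dots>, x\<^sub>n]\<close>, \<open>K = S/(x\<^sub>1, \<dots>, x\<^sub>n)\<close> and \<open>d = dim M\<close>. This is the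
  Cohen--Macaulay type if \<open>M\<close> is a graded Cohen--Macaulay module; modules of dimension \<open>0\<close>, such as
  quotients by ideals of height \<open>n\<close>, are always Cohen--Macaulay.
\<close>

definition cm_type :: "(('n::finite, 'k::field) mpol, 'b) module \<Rightarrow> nat" where
  "cm_type M = vectorspace.dim (ring_of_type_algebra :: 'k ring)
     (restrict_scalars const
       (ext_module mpol_ring (the_enat (module_krull_dim mpol_ring M))
          (quot_by_ideal (genideal mpol_ring (range var))) M))"

end

theory Submission
  imports Defs "HOL-Library.Countable_Set"
begin

text \<open>
  A monomial ideal of \<open>S = K[x\<^sub>1, \<dots>, x\<^sub>n]\<close> is the span of the monomials it contains, so \<open>I\<close> and \<open>J\<close>
  are described by upward closed sets \<open>A\<close> and \<open>B\<close> of exponent vectors, and \<open>I J\<close> by \<open>A + B\<close>.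

  Height \<open>n\<close> means that \<open>A\<close> and \<open>B\<close> contain a pure power of every variable but not the exponent \<open>0\<close>
  (\<open>monomial_ideal_full_height\<close>). Indeed, if no power of \<open>x\<^sub>i\<close> lies in \<open>I\<close>, then \<open>I\<close> is contained in
  the prime ideal generated by the other variables. This prime can be enlarged by \<open>x\<^sub>i\<close>, so its height
  is at most \<open>n - 1\<close> once chains of primes in \<open>S\<close> are known to have length at most \<open>n\<close>; that bound
  (\<open>no_long_prime_chain\<close>) comes from the algebraic dependence of any \<open>n + 1\<close> elements of \<open>S\<close>.

  Consequently \<open>S/IJ\<close> has dimension \<open>0\<close>, and its type is the dimension of
  \<open>Ext\<^sup>0(K, S/IJ) = Hom(K, S/IJ)\<close>. A homomorphism is determined by the image of \<open>1\<close>, which can be any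
  element killed by all variables; these elements have a basis of monomials, namely those whose
  exponent lies outside \<open>A + B\<close> but enters \<open>A + B\<close> when any coordinate is raised by one
  (\<open>cm_type_eq_card_socle\<close>). As \<open>Ext\<close> is computed from some chosen resolution, free resolutions have
  to exist with carriers in the prescribed type (\<open>free_resolution_exists\<close>): a submodule of a free
  module of countable rank has countable dimension over \<open>K\<close>, hence is again an image of that module.

  It remains to find three maximal elements of the finite complement of \<open>A + B\<close>. It suffices to
  find three points of the complement such that no two of them lie below a common point of the
  complement. Let \<open>a\<^sub>i\<close> and \<open>b\<^sub>i\<close> be the least pure powers of \<open>x\<^sub>i\<close> in \<open>I\<close> and \<open>J\<close>. Then
  \<open>(a\<^sub>i + b\<^sub>i - 1) e\<^sub>i\<close> is in the complement, and for \<open>i \<noteq> j\<close> every upper bound of two such points lies above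
  \<open>a\<^sub>i e\<^sub>i + b\<^sub>j e\<^sub>j\<close>, hence in \<open>A + B\<close>. This settles \<open>n \<ge> 3\<close>. For \<open>n = 2\<close> a third point is found at the inner
  corner of the staircase of \<open>A + B\<close>, unless both \<open>I\<close> and \<open>J\<close> are generated by two pure powers
  (\<open>socle_sumset_two_variables\<close>, \<open>min_gens_two_axes\<close>).
\<close>

abbreviation lookup where "lookup \<equiv> Poly_Mapping.lookup"
abbreviation keys where "keys \<equiv> Poly_Mapping.keys"
abbreviation single where "single \<equiv> Poly_Mapping.single"

section \<open>Staircases of exponent vectors\<close>

definition upset :: "('n \<Rightarrow>\<^sub>0 nat) set \<Rightarrow> bool" where
  "upset E \<longleftrightarrow> (\<forall>a\<in>E. \<forall>c. a + c \<in> E)"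

text \<open>
  The maximal elements of the complement of an upward closed set \<open>E\<close>: the exponents of a monomial
  basis of \<open>(L : (x\<^sub>1, \<dots>, x\<^sub>n)) / L\<close>, where \<open>L\<close> is the monomial ideal with exponent set \<open>E\<close>.
\<close>

definition socle :: "('n \<Rightarrow>\<^sub>0 nat) set \<Rightarrow> ('n \<Rightarrow>\<^sub>0 nat) set" where
  "socle E = {a. a \<notin> E \<and> (\<forall>i. a + single i 1 \<in> E)}"

definition pure_powers :: "('n \<Rightarrow>\<^sub>0 nat) set \<Rightarrow> bool" where
  "pure_powers E \<longleftrightarrow> (\<forall>i. \<exists>c. single i c \<in> E)"

definition sumset :: "('n \<Rightarrow>\<^sub>0 nat) set \<Rightarrow> ('n \<Rightarrow>\<^sub>0 nat) set \<Rightarrow> ('n \<Rightarrow>\<^sub>0 nat) set" where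
  "sumset A B = {a + b | a b. a \<in> A \<and> b \<in> B}"

lemma upset_mono:
  assumes "upset E" "a \<in> E" "\<And>i. lookup a i \<le> lookup b i"
  shows "b \<in> E"
proof -
  have "b = a + (b - a)"
    using assms(3) by (intro poly_mapping_eqI) (simp add: lookup_add lookup_minus)
  thus ?thesis using assms(1,2) unfolding upset_def by metis
qed

lemma upset_sumset:
  assumes "upset A"
  shows "upset (sumset A B)"
  unfolding upset_def sumset_def
proof safe
  fix a b c assume "a \<in> A" "b \<in> B"
  then have "a + c \<in> A" using assms by (auto simp: upset_def)
  moreover have "a + b + c = (a + c) + b" by (simp only: ac_simps)
  ultimately show "\<exists>a' b'. a + b + c = a' + b' \<and> a' \<in> A \<and> b' \<in> B"
    using \<open>b \<in> B\<close> by (intro exI[of _ "a + c"] exI[of _ b]) simp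
qed

lemma sumset_commute: "sumset A B = sumset B A"
  unfolding sumset_def by (auto intro: add.commute)

definition least_power :: "('n \<Rightarrow>\<^sub>0 nat) set \<Rightarrow> 'n \<Rightarrow> nat" where
  "least_power E i = (LEAST c. single i c \<in> E)"

lemma single_least_power: "pure_powers E \<Longrightarrow> single i (least_power E i) \<in> E"
  unfolding least_power_def pure_powers_def by (rule LeastI_ex) simp

lemma least_power_le: "single i c \<in> E \<Longrightarrow> least_power E i \<le> c"
  unfolding least_power_def by (rule Least_le)

lemma least_power_pos: "pure_powers E \<Longrightarrow> 0 \<notin> E \<Longrightarrow> 0 < least_power E i"
  using single_least_power[of E i] by (cases "least_power E i = 0") simp_all

lemma finite_Compl_upset:
  fixes E :: "('n::finite \<Rightarrow>\<^sub>0 nat) set"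
  assumes "upset E" "pure_powers E"
  shows "finite (- E)"
proof -
  define c where "c = least_power E"
  have c: "single i (c i) \<in> E" for i
    using assms(2) by (simp add: c_def single_least_power)
  have "lookup a i \<le> c i" if "a \<notin> E" for a i
  proof (rule ccontr)
    assume "\<not> lookup a i \<le> c i"
    then have "a \<in> E"
      using c[of i] by (intro upset_mono[OF assms(1) c[of i]]) (auto simp: lookup_single when_def)
    thus False using that by simp
  qed
  then have "lookup ` (- E) \<subseteq> (\<Pi>\<^sub>E i\<in>UNIV. {..c i})" by auto
  then have "finite (lookup ` (- E))" by (rule finite_subset) (simp add: finite_PiE)
  thus ?thesis by (rule finite_imageD) (simp add: inj_on_def poly_mapping_eqI)
qed

lemma finite_socle: "finite (- E) \<Longrightarrow> finite (socle E)"
  by (rule finite_subset[of _ "- E"]) (auto simp: socle_def)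

text \<open>
  Among the finitely many exponents above \<open>p\<close> outside \<open>E\<close>, one of maximal total degree cannot be
  raised in any coordinate.
\<close>

lemma socle_above:
  fixes E :: "('n::finite \<Rightarrow>\<^sub>0 nat) set"
  assumes "finite (- E)" "p \<notin> E"
  obtains t where "t \<in> socle E" "\<And>i. lookup p i \<le> lookup t i"
proof -
  define D where "D = {t. t \<notin> E \<and> (\<forall>i. lookup p i \<le> lookup t i)}"
  define deg :: "('n \<Rightarrow>\<^sub>0 nat) \<Rightarrow> nat" where "deg t = (\<Sum>i\<in>UNIV. lookup t i)" for t
  have "D \<subseteq> - E" by (auto simp: D_def)
  then have D: "finite D" "p \<in> D" using assms by (auto simp: D_def finite_subset)
  then have "Max (deg ` D) \<in> deg ` D" by (intro Max_in) auto
  then obtain t where t: "t \<in> D" "deg t = Max (deg ` D)" by auto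
  have "t + single i 1 \<in> E" for i
  proof (rule ccontr)
    assume "t + single i 1 \<notin> E"
    then have "t + single i 1 \<in> D"
      using t(1) by (auto simp: D_def lookup_add intro: trans_le_add1)
    then have "deg (t + single i 1) \<le> deg t" using t(2) D by simp
    moreover have "deg (t + single i 1) = deg t + 1"
      by (simp add: deg_def lookup_add sum.distrib lookup_single when_def)
    ultimately show False by simp
  qed
  thus ?thesis using t(1) that[of t] by (auto simp: D_def socle_def)
qed

text \<open>
  The three socle elements above \<open>p\<close>, \<open>q\<close> and \<open>r\<close> are distinct, because an element above two of these
  points lies in \<open>E\<close>.
\<close>

lemma three_le_card_socle:
  fixes E :: "('n::finite \<Rightarrow>\<^sub>0 nat) set"
  assumes "finite (- E)" "p \<notin> E" "q \<notin> E" "r \<notin> E"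
    and pq: "\<And>s. (\<And>i. lookup p i \<le> lookup s i) \<Longrightarrow> (\<And>i. lookup q i \<le> lookup s i) \<Longrightarrow> s \<in> E"
    and pr: "\<And>s. (\<And>i. lookup p i \<le> lookup s i) \<Longrightarrow> (\<And>i. lookup r i \<le> lookup s i) \<Longrightarrow> s \<in> E"
    and qr: "\<And>s. (\<And>i. lookup q i \<le> lookup s i) \<Longrightarrow> (\<And>i. lookup r i \<le> lookup s i) \<Longrightarrow> s \<in> E"
  shows "3 \<le> card (socle E)"
proof -
  obtain p' where p': "p' \<in> socle E" "\<And>i. lookup p i \<le> lookup p' i"
    using socle_above assms(1,2) by blast
  obtain q' where q': "q' \<in> socle E" "\<And>i. lookup q i \<le> lookup q' i"
    using socle_above assms(1,3) by blast
  obtain r' where r': "r' \<in> socle E" "\<And>i. lookup r i \<le> lookup r' i"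
    using socle_above assms(1,4) by blast
  have "p' \<noteq> q'" "p' \<noteq> r'" "q' \<noteq> r'"
    using pq[of p'] pr[of p'] qr[of q'] p' q' r' by (auto simp: socle_def)
  then have "3 = card {p', q', r'}" by simp
  also have "\<dots> \<le> card (socle E)"
    using p'(1) q'(1) r'(1) assms(1)
    by (intro card_mono finite_socle) auto
  finally show ?thesis .
qed

lemma add_eq_single:
  fixes s t :: "'n \<Rightarrow>\<^sub>0 nat"
  assumes "s + t = single i m"
  shows "s = single i (lookup s i)" "t = single i (lookup t i)" "lookup s i + lookup t i = m"
proof -
  have *: "lookup s k + lookup t k = (if k = i then m else 0)" for k
    using arg_cong[OF assms, of "\<lambda>a. lookup a k"] by (simp add: lookup_add lookup_single when_def)
  show "s = single i (lookup s i)"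
  proof (rule poly_mapping_eqI)
    show "lookup s k = lookup (single i (lookup s i)) k" for k
      using *[of k] by (cases "k = i") (auto simp: lookup_single when_def)
  qed
  show "t = single i (lookup t i)"
  proof (rule poly_mapping_eqI)
    show "lookup t k = lookup (single i (lookup t i)) k" for k
      using *[of k] by (cases "k = i") (auto simp: lookup_single when_def)
  qed
  show "lookup s i + lookup t i = m" using *[of i] by simp
qed

text \<open>
  A sum of two exponent vectors lies on an axis only if both summands do.
\<close>

lemma least_power_sumset:
  assumes "single i m \<in> sumset A B"
  shows "least_power A i + least_power B i \<le> m"
proof -
  obtain s t where st: "s \<in> A" "t \<in> B" "s + t = single i m"
    using assms unfolding sumset_def by auto
  have "least_power A i \<le> lookup s i"
    by (rule least_power_le, subst add_eq_single(1)[OF st(3), symmetric], rule st(1))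
  moreover have "least_power B i \<le> lookup t i"
    by (rule least_power_le, subst add_eq_single(2)[OF st(3), symmetric], rule st(2))
  ultimately show ?thesis using add_eq_single(3)[OF st(3)] by linarith
qed

text \<open>
  The element lies above the sum of the pure power of \<open>x\<^sub>i\<close> from \<open>A\<close> and the pure power of \<open>x\<^sub>j\<close> from \<open>B\<close>.
\<close>

lemma sumset_crossI:
  fixes A B :: "('n \<Rightarrow>\<^sub>0 nat) set"
  assumes "upset A" "pure_powers A" "pure_powers B" "i \<noteq> j"
    and "least_power A i \<le> lookup s i" "least_power B j \<le> lookup s j"
  shows "s \<in> sumset A B"
proof (rule upset_mono[OF upset_sumset[OF assms(1)]])
  show "single i (least_power A i) + single j (least_power B j) \<in> sumset A B"
    using assms(2,3) by (auto simp: sumset_def intro: single_least_power)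
  show "lookup (single i (least_power A i) + single j (least_power B j)) k \<le> lookup s k" for k
    using assms(4-6) by (auto simp: lookup_add lookup_single when_def)
qed

lemma pure_powers_sumset:
  assumes "pure_powers A" "pure_powers B"
  shows "pure_powers (sumset A B)"
  unfolding pure_powers_def
proof
  fix i
  have "single i (least_power A i + least_power B i) \<in> sumset A B"
    using single_least_power[OF assms(1), of i] single_least_power[OF assms(2), of i]
    by (auto simp: sumset_def single_add)
  thus "\<exists>c. single i c \<in> sumset A B" ..
qed

text \<open>
  The last point on the \<open>i\<close>-th axis that is still outside \<open>A + B\<close>.
\<close>

definition axis_point :: "('n \<Rightarrow>\<^sub>0 nat) set \<Rightarrow> ('n \<Rightarrow>\<^sub>0 nat) set \<Rightarrow> 'n \<Rightarrow> ('n \<Rightarrow>\<^sub>0 nat)" where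
  "axis_point A B i = single i (least_power A i + least_power B i - 1)"

lemma axis_point_notin:
  assumes "pure_powers A" "pure_powers B" "0 \<notin> A"
  shows "axis_point A B i \<notin> sumset A B"
  using least_power_sumset[of i _ A B] least_power_pos[of A i] assms
  unfolding axis_point_def by fastforce

text \<open>
  An upper bound of both points has \<open>i\<close>-th coordinate at least \<open>a\<^sub>i + b\<^sub>i - 1 \<ge> a\<^sub>i\<close> and \<open>j\<close>-th coordinate
  at least \<open>a\<^sub>j + b\<^sub>j - 1 \<ge> b\<^sub>j\<close>, since \<open>b\<^sub>i\<close> and \<open>a\<^sub>j\<close> are positive.
\<close>

lemma axis_points_join:
  assumes "upset A" "pure_powers A" "pure_powers B" "0 \<notin> A" "0 \<notin> B" "i \<noteq> j"
    and "\<And>k. lookup (axis_point A B i) k \<le> lookup s k"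
    and "\<And>k. lookup (axis_point A B j) k \<le> lookup s k"
  shows "s \<in> sumset A B"
  using assms(7)[of i] assms(8)[of j] least_power_pos[of A j] least_power_pos[of B i] assms(1-6)
  by (intro sumset_crossI[of A B i j]) (auto simp: axis_point_def)

lemma socle_sumset_three_variables:
  fixes A B :: "('n::finite \<Rightarrow>\<^sub>0 nat) set"
  assumes "upset A" "pure_powers A" "pure_powers B" "0 \<notin> A" "0 \<notin> B" "3 \<le> CARD('n)"
  shows "3 \<le> card (socle (sumset A B))"
proof -
  obtain D :: "'n set" where "card D = 3"
    using obtain_subset_with_card_n[OF assms(6)] by auto
  then have "\<exists>i j k. D = {i, j, k} \<and> i \<noteq> j \<and> j \<noteq> k \<and> i \<noteq> k"
    unfolding card_3_iff by blast
  then obtain i j k :: 'n where "i \<noteq> j" "i \<noteq> k" "j \<noteq> k" by blast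
  note out = axis_point_notin[OF assms(2,3,4)]
  note join = axis_points_join[OF assms(1-5)]
  have fin: "finite (- sumset A B)"
    by (rule finite_Compl_upset[OF upset_sumset[OF assms(1)] pure_powers_sumset[OF assms(2,3)]])
  show ?thesis
    by (rule three_le_card_socle[OF fin out[of i] out[of j] out[of k]])
      (rule join[OF \<open>i \<noteq> j\<close>] join[OF \<open>i \<noteq> k\<close>] join[OF \<open>j \<noteq> k\<close>]; assumption)+
qed

text \<open>
  Besides the two axis points, the third point is the corner \<open>(u, v)\<close>, where \<open>u\<close> is the first column in
  which the staircase of \<open>A + B\<close> is lower than on the \<open>j\<close>-th axis, and \<open>v\<close> is the first row in which it
  is shorter than on the \<open>i\<close>-th axis. By the choice
  of \<open>u\<close> and \<open>v\<close>, its upper bounds with the axis points are in \<open>A + B\<close>. If \<open>(u, v)\<close> itself were in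
  \<open>A + B\<close>, say equal to \<open>s + t\<close>, then translating elements of \<open>A\<close> and \<open>B\<close> by pure powers of the other set
  shows that one of \<open>s\<close>, \<open>t\<close> lies on the first axis and the other on the second, and that \<open>(u, v)\<close> is
  \<open>(a\<^sub>i, b\<^sub>j)\<close> or \<open>(b\<^sub>i, a\<^sub>j)\<close>. Both possibilities exclude an element \<open>x\<close> of \<open>A\<close> that is smaller than both
  pure powers.
\<close>

lemma socle_sumset_two_variables:
  fixes A B :: "('n::finite \<Rightarrow>\<^sub>0 nat) set"
  assumes "upset A" "pure_powers A" "upset B" "pure_powers B" "0 \<notin> A" "0 \<notin> B"
    and "UNIV = {i, j}" "i \<noteq> j"
    and x: "x \<in> A" "lookup x i < least_power A i" "lookup x j < least_power A j"
  shows "3 \<le> card (socle (sumset A B))"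
proof -
  define C where "C = sumset A B"
  define pt where "pt m n = single i m + single j n" for m n :: nat
  have lpt [simp]: "lookup (pt m n) i = m" "lookup (pt m n) j = n" for m n
    using assms(8) by (simp_all add: pt_def lookup_add lookup_single)
  have ij: "k = i \<or> k = j" for k
    using UNIV_I[of k] unfolding assms(7) by simp
  have pt_eq: "pt (lookup s i) (lookup s j) = s" for s
  proof (rule poly_mapping_eqI)
    show "lookup (pt (lookup s i) (lookup s j)) k = lookup s k" for k
      using ij[of k] by (elim disjE) (simp_all only: lpt)
  qed
  have mono: "s \<in> C" if "t \<in> C" "lookup t i \<le> lookup s i" "lookup t j \<le> lookup s j" for s t
    unfolding C_def
  proof (rule upset_mono[OF upset_sumset[OF assms(1)]])
    show "t \<in> sumset A B" using that(1) by (simp add: C_def)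
    show "lookup t k \<le> lookup s k" for k using that(2,3) ij[of k] by (elim disjE) simp_all
  qed
  define a where "a = least_power A"
  define b where "b = least_power B"
  have pos: "0 < a k" "0 < b k" for k
    using assms by (auto simp: a_def b_def intro: least_power_pos)
  have cross: "s \<in> C" if "a i \<le> lookup s i \<and> b j \<le> lookup s j \<or> b i \<le> lookup s i \<and> a j \<le> lookup s j" for s
    using that sumset_crossI[OF assms(1,2,4,8), of s] sumset_crossI[OF assms(3,4,2,8), of s]
    by (auto simp: C_def a_def b_def sumset_commute[of A B])
  have out: "axis_point A B k \<notin> C" for k
    using axis_point_notin[OF assms(2,4,5)] by (simp add: C_def)
  have axis: "axis_point A B i = pt (a i + b i - 1) 0" "axis_point A B j = pt 0 (a j + b j - 1)"
    by (simp_all add: axis_point_def pt_def a_def b_def)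
  \<comment> \<open>Row \<open>a j + b j - 1\<close> and column \<open>a i + b i - 1\<close> are those of the axis points.\<close>
  define u where "u = (LEAST u. pt u (a j + b j - 1) \<in> C)"
  define v where "v = (LEAST v. pt (a i + b i - 1) v \<in> C)"
  have ai: "pt (a i) (a j + b j - 1) \<in> C" and bi: "pt (b i) (a j + b j - 1) \<in> C"
    and aj: "pt (a i + b i - 1) (a j) \<in> C" and bj: "pt (a i + b i - 1) (b j) \<in> C"
    using pos[of i] pos[of j] by (auto intro!: cross)
  have u: "pt u (a j + b j - 1) \<in> C" unfolding u_def by (rule LeastI, rule ai)
  have v: "pt (a i + b i - 1) v \<in> C" unfolding v_def by (rule LeastI, rule aj)
  have u_le: "u \<le> m" if "pt m (a j + b j - 1) \<in> C" for m
    using that unfolding u_def by (rule Least_le)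
  have v_le: "v \<le> m" if "pt (a i + b i - 1) m \<in> C" for m
    using that unfolding v_def by (rule Least_le)
  have u_pos: "0 < u" using u out[of j] axis by (metis gr0I)
  have v_pos: "0 < v" using v out[of i] axis by (metis gr0I)
  \<comment> \<open>Adding the pure power \<open>b j\<close> to \<open>s\<close> would give a point of \<open>A + B\<close> below row \<open>a j + b j\<close> and left of column \<open>u\<close>.\<close>
  have A1: "a j \<le> lookup s j" if "s \<in> A" "lookup s i < u" for s
  proof (rule ccontr)
    assume *: "\<not> a j \<le> lookup s j"
    have "s + single j (b j) \<in> C"
      using that assms(4) by (auto simp: C_def sumset_def b_def intro: single_least_power)
    then have "pt (lookup s i) (a j + b j - 1) \<in> C"
      by (rule mono) (use * assms(8) in \<open>auto simp: lookup_add lookup_single\<close>)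
    then show False using u_le that(2) by force
  qed
  have A2: "a i \<le> lookup s i" if "s \<in> A" "lookup s j < v" for s
  proof (rule ccontr)
    assume *: "\<not> a i \<le> lookup s i"
    have "s + single i (b i) \<in> C"
      using that assms(4) by (auto simp: C_def sumset_def b_def intro: single_least_power)
    then have "pt (a i + b i - 1) (lookup s j) \<in> C"
      by (rule mono) (use * assms(8) in \<open>auto simp: lookup_add lookup_single\<close>)
    then show False using v_le that(2) by force
  qed
  have B1: "b j \<le> lookup t j" if "t \<in> B" "lookup t i < u" for t
  proof (rule ccontr)
    assume *: "\<not> b j \<le> lookup t j"
    have "single j (a j) + t \<in> C"
      using that assms(2) by (auto simp: C_def sumset_def a_def intro: single_least_power)
    then have "pt (lookup t i) (a j + b j - 1) \<in> C"
      by (rule mono) (use * assms(8) in \<open>auto simp: lookup_add lookup_single\<close>)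
    then show False using u_le that(2) by force
  qed
  have "pt u v \<notin> C"
  proof
    assume "pt u v \<in> C"
    then obtain s t where st: "s \<in> A" "t \<in> B" "pt u v = s + t" by (auto simp: C_def sumset_def)
    have ui: "lookup s i + lookup t i = u" and vj: "lookup s j + lookup t j = v"
      using arg_cong[OF st(3), of "\<lambda>a. lookup a i"] arg_cong[OF st(3), of "\<lambda>a. lookup a j"]
      by (simp_all add: lookup_add)
    have xu: "u \<le> lookup x i" using A1[OF x(1)] x(3) by (force simp: a_def)
    have xv: "v \<le> lookup x j" using A2[OF x(1)] x(2) by (force simp: a_def)
    show False
    proof (cases "lookup s i < u")
      case True
      then show False using A1[OF st(1)] vj xv x(3) by (simp add: a_def)
    next
      case False
      then have "lookup t i = 0" "lookup s i = u" using ui by auto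
      with B1[OF st(2)] u_pos have "b j \<le> lookup t j" by simp
      moreover have "v \<le> b j" by (rule v_le[OF bj])
      ultimately have "lookup s j = 0" using vj by simp
      then have "s = single i u"
        using pt_eq[of s] \<open>lookup s i = u\<close> by (simp add: pt_def)
      then have "a i \<le> u" using st(1) by (simp add: a_def least_power_le)
      then show False using xu x(2) by (simp add: a_def)
    qed
  qed
  show ?thesis
  proof (rule three_le_card_socle[OF finite_Compl_upset[OF upset_sumset pure_powers_sumset]])
    show "axis_point A B i \<notin> sumset A B" "axis_point A B j \<notin> sumset A B" "pt u v \<notin> sumset A B"
      using out \<open>pt u v \<notin> C\<close> by (simp_all add: C_def)
  next
    fix s assume "\<And>k. lookup (axis_point A B i) k \<le> lookup s k" "\<And>k. lookup (axis_point A B j) k \<le> lookup s k"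
    then show "s \<in> sumset A B" by (rule axis_points_join[OF assms(1,2,4,5,6,8)])
  next
    fix s assume "\<And>k. lookup (axis_point A B i) k \<le> lookup s k" "\<And>k. lookup (pt u v) k \<le> lookup s k"
    from this(1)[of i] this(2)[of j] show "s \<in> sumset A B"
      using mono[OF v, of s] by (simp add: axis C_def)
  next
    fix s assume "\<And>k. lookup (axis_point A B j) k \<le> lookup s k" "\<And>k. lookup (pt u v) k \<le> lookup s k"
    from this(1)[of j] this(2)[of i] show "s \<in> sumset A B"
      using mono[OF u, of s] by (simp add: axis C_def)
  qed (use assms in auto)
qed

section \<open>Ideals of a commutative ring type\<close>

lemma ring_of_type_algebra_simps [simp]:
  "carrier ring_of_type_algebra = (UNIV :: 'a::comm_ring_1 set)"
  "x \<otimes>\<^bsub>ring_of_type_algebra\<^esub> y = x * (y :: 'a)"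
  "x \<oplus>\<^bsub>ring_of_type_algebra\<^esub> y = x + (y :: 'a)"
  "\<one>\<^bsub>ring_of_type_algebra\<^esub> = (1 :: 'a)"
  "\<zero>\<^bsub>ring_of_type_algebra\<^esub> = (0 :: 'a)"
  by (simp_all add: ring_of_type_algebra_def)

lemma a_inv_ring_of_type_algebra:
  "\<ominus>\<^bsub>ring_of_type_algebra\<^esub> x = - (x :: 'a::comm_ring_1)"
proof -
  interpret cring "ring_of_type_algebra :: 'a ring" by (rule cring_from_type_algebra)
  show ?thesis by (rule minus_equality) simp_all
qed

text \<open>
  Over a ring type, an ideal in the sense of locales amounts to three closure conditions without
  carriers; inverses come from multiplication by \<open>-1\<close>.
\<close>

lemma ideal_ring_of_type_algebra_iff:
  "ideal I ring_of_type_algebra \<longleftrightarrow>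
     0 \<in> I \<and> (\<forall>x\<in>I. \<forall>y\<in>I. x + y \<in> I) \<and> (\<forall>x\<in>I. \<forall>r. r * x \<in> I)" (is "?L \<longleftrightarrow> ?R")
  for I :: "'a::comm_ring_1 set"
proof
  assume ?L
  note I = ideal.axioms(1)[OF this]
  show ?R
    using additive_subgroup.zero_closed[OF I] additive_subgroup.a_closed[OF I] ideal.I_l_closed[OF \<open>?L\<close>]
    by simp
next
  assume I: ?R
  interpret cring "ring_of_type_algebra :: 'a ring" by (rule cring_from_type_algebra)
  have inv: "- x \<in> I" if "x \<in> I" for x
  proof -
    have "(- 1) * x \<in> I" using I that by blast
    thus ?thesis by simp
  qed
  show ?L
  proof (rule idealI)
    show "subgroup I (add_monoid (ring_of_type_algebra :: 'a ring))"
    proof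
      show "inv\<^bsub>add_monoid ring_of_type_algebra\<^esub> x \<in> I" if "x \<in> I" for x
        using inv[OF that] by (simp flip: a_inv_ring_of_type_algebra add: a_inv_def)
    qed (use I in simp_all)
  qed (use I in \<open>simp_all add: ring_axioms mult.commute\<close>)
qed

lemma ideal_diff:
  fixes x y :: "'a::comm_ring_1"
  assumes "ideal I ring_of_type_algebra" "x \<in> I" "y \<in> I"
  shows "x - y \<in> I"
proof -
  have "(- 1) * y \<in> I" using assms unfolding ideal_ring_of_type_algebra_iff by blast
  then have "x + (- 1) * y \<in> I" using assms unfolding ideal_ring_of_type_algebra_iff by blast
  thus ?thesis by simp
qed

lemma ideal_sum:
  fixes f :: "'b \<Rightarrow> 'a::comm_ring_1"
  assumes "ideal I ring_of_type_algebra" "\<And>x. x \<in> A \<Longrightarrow> f x \<in> I"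
  shows "sum f A \<in> I"
  using assms(2)
proof (induction A rule: infinite_finite_induct)
  case (insert x A)
  then show ?case using assms(1) unfolding ideal_ring_of_type_algebra_iff by simp
qed (use assms(1) in \<open>simp_all add: ideal_ring_of_type_algebra_iff\<close>)

lemma ideal_eq_UNIV:
  fixes I :: "'a::comm_ring_1 set"
  assumes "ideal I ring_of_type_algebra" "1 \<in> I"
  shows "I = UNIV"
proof -
  have "r * 1 \<in> I" for r using assms unfolding ideal_ring_of_type_algebra_iff by blast
  thus ?thesis by auto
qed

lemma primeideal_ring_of_type_algebra_iff:
  "primeideal P ring_of_type_algebra \<longleftrightarrow>
     ideal P ring_of_type_algebra \<and> 1 \<notin> P \<and> (\<forall>x y. x * y \<in> P \<longrightarrow> x \<in> P \<or> y \<in> P)" (is "?L \<longleftrightarrow> ?R")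
  for P :: "'a::comm_ring_1 set"
proof
  assume ?L
  then interpret primeideal P "ring_of_type_algebra :: 'a ring" .
  have "P \<noteq> UNIV" using I_notcarr by simp
  then show ?R using is_ideal ideal_eq_UNIV[OF is_ideal] I_prime by auto
next
  assume P: ?R
  have "carrier (ring_of_type_algebra :: 'a ring) \<noteq> P" using P by auto
  moreover have "cring (ring_of_type_algebra :: 'a ring)" by (rule cring_from_type_algebra)
  ultimately show ?L using P by (intro primeidealI) auto
qed

lemma primeideal_power:
  fixes x :: "'a::comm_ring_1"
  assumes "primeideal P ring_of_type_algebra" "x ^ k \<in> P"
  shows "x \<in> P"
  using assms(2)
proof (induction k)
  case 0
  then show ?case using assms(1) by (simp add: primeideal_ring_of_type_algebra_iff)
next
  case (Suc k)
  then show ?case using assms(1) by (auto simp: primeideal_ring_of_type_algebra_iff)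
qed

lemma genideal_minimal:
  fixes I :: "'a::comm_ring_1 set"
  assumes "ideal I ring_of_type_algebra" "A \<subseteq> I"
  shows "genideal ring_of_type_algebra A \<subseteq> I"
  using assms unfolding genideal_def by auto

lemma genideal_is_ideal:
  fixes A :: "'a::comm_ring_1 set"
  shows "ideal (genideal ring_of_type_algebra A) ring_of_type_algebra"
proof -
  interpret cring "ring_of_type_algebra :: 'a ring" by (rule cring_from_type_algebra)
  show ?thesis by (rule genideal_ideal) simp
qed

lemma genideal_superset:
  fixes A :: "'a::comm_ring_1 set"
  shows "A \<subseteq> genideal ring_of_type_algebra A"
  unfolding genideal_def by auto

section \<open>Monomial ideals and exponent sets\<close>

text \<open>
  The \<open>K\<close>-span of the monomials with exponent in \<open>E\<close>. For upward closed \<open>E\<close> these are exactly the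
  monomial ideals.
\<close>

definition monomial_span :: "('n \<Rightarrow>\<^sub>0 nat) set \<Rightarrow> ('n::finite, 'k::field) mpol set" where
  "monomial_span E = {p. keys p \<subseteq> E}"

lemma const_1 [simp]: "const 1 = 1" by (simp add: const_def)
lemma const_add: "const (c + d) = const c + const d" by (simp add: const_def single_add)
lemma const_mult: "const (c * d) = const c * const d" by (simp add: const_def mult_single)
lemma monomial_0 [simp]: "monomial 0 = 1" by (simp add: monomial_def)
lemma monomial_add: "monomial (a + b) = monomial a * monomial b" by (simp add: monomial_def mult_single)
lemma const_monomial: "const c * monomial a = single a c" by (simp add: const_def monomial_def mult_single)

lemma lookup_const_mult [simp]: "lookup (const c * p) a = c * lookup p a"
  unfolding const_def by (simp flip: mult_map_scale_conv_mult add: Poly_Mapping.map.rep_eq when_def)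

lemma monomial_power: "monomial (single i 1) ^ k = monomial (single i k)"
  by (induction k) (simp_all flip: monomial_add single_add)

lemma mpol_expansion: "p = (\<Sum>a\<in>keys p. const (lookup p a) * monomial a)"
  by (rule poly_mapping_eqI)
    (simp add: lookup_sum const_monomial lookup_single when_def in_keys_iff sum.delta)

lemma monomial_in_monomial_span_iff [simp]: "monomial a \<in> monomial_span E \<longleftrightarrow> a \<in> E"
  by (simp add: monomial_span_def monomial_def)

lemma monomial_span_mult:
  assumes "p \<in> monomial_span A" "q \<in> monomial_span B"
  shows "p * q \<in> monomial_span (sumset A B)"
  using assms keys_mult[of p q] unfolding monomial_span_def sumset_def by fast

lemma monomial_span_mono: "A \<subseteq> B \<Longrightarrow> monomial_span A \<subseteq> monomial_span B"
  by (auto simp: monomial_span_def)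

lemma monomial_span_ideal:
  assumes "upset E"
  shows "ideal (monomial_span E :: ('n::finite, 'k::field) mpol set) mpol_ring"
  unfolding ideal_ring_of_type_algebra_iff
proof (intro conjI ballI allI)
  fix x y :: "('n, 'k) mpol"
  show "0 \<in> (monomial_span E :: ('n, 'k) mpol set)" by (simp add: monomial_span_def)
  assume x: "x \<in> monomial_span E"
  { assume "y \<in> monomial_span E"
    then show "x + y \<in> monomial_span E" using x keys_add[of x y] by (auto simp: monomial_span_def) }
  have "sumset E UNIV \<subseteq> E" using assms by (auto simp: sumset_def upset_def)
  then have "sumset UNIV E \<subseteq> E" by (simp add: sumset_commute)
  then show "y * x \<in> monomial_span E"
    using monomial_span_mult[of y UNIV x E] x monomial_span_mono by (auto simp: monomial_span_def)
qed

text \<open>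
  A polynomial is a linear combination of the monomials in its support.
\<close>

lemma monomial_span_minimal:
  fixes I :: "('n::finite, 'k::field) mpol set"
  assumes "ideal I mpol_ring" "\<And>a. a \<in> E \<Longrightarrow> monomial a \<in> I"
  shows "monomial_span E \<subseteq> I"
proof
  fix p :: "('n, 'k) mpol" assume "p \<in> monomial_span E"
  then have "monomial a \<in> I" if "a \<in> keys p" for a using that assms(2) by (auto simp: monomial_span_def)
  then have "(\<Sum>a\<in>keys p. const (lookup p a) * monomial a) \<in> I"
    using assms(1) by (intro ideal_sum) (simp_all add: ideal_ring_of_type_algebra_iff)
  then show "p \<in> I" by (simp flip: mpol_expansion)
qed

definition upset_of :: "('n \<Rightarrow>\<^sub>0 nat) set \<Rightarrow> ('n \<Rightarrow>\<^sub>0 nat) set" where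
  "upset_of G = sumset G UNIV"

lemma upset_upset_of: "upset (upset_of G)"
  unfolding upset_of_def sumset_commute[of G] by (rule upset_sumset) (simp add: upset_def)

lemma subset_upset_of: "G \<subseteq> upset_of G"
  by (force simp: upset_of_def sumset_def intro: exI[of _ 0])

lemma genideal_monomials:
  "genideal mpol_ring (monomial ` G) = (monomial_span (upset_of G) :: ('n::finite, 'k::field) mpol set)"
proof
  show "genideal mpol_ring (monomial ` G) \<subseteq> (monomial_span (upset_of G) :: ('n, 'k) mpol set)"
    using subset_upset_of[of G] by (intro genideal_minimal monomial_span_ideal upset_upset_of) auto
  have "monomial a \<in> (genideal mpol_ring (monomial ` G) :: ('n, 'k) mpol set)" if "a \<in> upset_of G" for a
  proof -
    obtain g c where a: "a = c + g" "g \<in> G"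
      using \<open>a \<in> upset_of G\<close> unfolding upset_of_def sumset_commute[of G] by (auto simp: sumset_def)
    have "monomial g \<in> (genideal mpol_ring (monomial ` G) :: ('n, 'k) mpol set)"
      using a(2) genideal_superset by blast
    with genideal_is_ideal[of "monomial ` G :: ('n, 'k) mpol set"] show ?thesis
      unfolding a(1) monomial_add ideal_ring_of_type_algebra_iff by blast
  qed
  then show "monomial_span (upset_of G) \<subseteq> (genideal mpol_ring (monomial ` G) :: ('n, 'k) mpol set)"
    by (intro monomial_span_minimal genideal_is_ideal)
qed

lemma monomial_idealE:
  assumes "monomial_ideal I"
  obtains E where "upset E" "I = monomial_span E"
proof -
  obtain A where A: "A \<subseteq> range monomial" "I = genideal mpol_ring A"
    using assms unfolding monomial_ideal_def by blast
  from A(1) obtain G where "A = monomial ` G" unfolding subset_image_iff by blast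
  then show ?thesis using that[OF upset_upset_of] A(2) genideal_monomials by blast
qed

lemma ideal_prod_monomial_span:
  assumes "upset A" "upset B"
  shows "ideal_prod mpol_ring (monomial_span A) (monomial_span B) = (monomial_span (sumset A B) :: ('n::finite, 'k::field) mpol set)"
proof
  show "ideal_prod mpol_ring (monomial_span A) (monomial_span B) \<subseteq> (monomial_span (sumset A B) :: ('n, 'k) mpol set)"
  proof
    fix p :: "('n, 'k) mpol" assume "p \<in> ideal_prod mpol_ring (monomial_span A) (monomial_span B)"
    then show "p \<in> monomial_span (sumset A B)"
    proof induction
      case (prod i j)
      then show ?case by (simp add: monomial_span_mult)
    next
      case (sum s t)
      have "ideal (monomial_span (sumset A B) :: ('n, 'k) mpol set) mpol_ring"
        by (rule monomial_span_ideal[OF upset_sumset[OF assms(1)]])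
      with sum show ?case by (simp add: ideal_ring_of_type_algebra_iff)
    qed
  qed
  interpret cring "mpol_ring :: ('n, 'k) mpol ring" by (rule cring_from_type_algebra)
  have "ideal (ideal_prod mpol_ring (monomial_span A) (monomial_span B)) (mpol_ring :: ('n, 'k) mpol ring)"
    by (rule ideal_prod_is_ideal[OF monomial_span_ideal[OF assms(1)] monomial_span_ideal[OF assms(2)]])
  then show "monomial_span (sumset A B) \<subseteq> (ideal_prod mpol_ring (monomial_span A) (monomial_span B) :: ('n, 'k) mpol set)"
  proof (rule monomial_span_minimal)
    fix a assume "a \<in> sumset A B"
    then obtain s t where st: "s \<in> A" "t \<in> B" "a = s + t" by (auto simp: sumset_def)
    then have "monomial s \<otimes>\<^bsub>mpol_ring\<^esub> monomial t \<in> ideal_prod mpol_ring (monomial_span A) (monomial_span B)"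
      by (intro ideal_prod.prod) simp_all
    then show "(monomial a :: ('n, 'k) mpol) \<in> ideal_prod mpol_ring (monomial_span A) (monomial_span B)"
      by (simp add: st(3) monomial_add)
  qed
qed

lemma monomial_span_one_iff: "1 \<in> (monomial_span E :: ('n::finite, 'k::field) mpol set) \<longleftrightarrow> 0 \<in> E"
  using monomial_in_monomial_span_iff[of 0 E] by simp

text \<open>
  A nonzero exponent vector has a positive coordinate, so its monomial is a multiple of a variable.
\<close>

lemma maximal_ideal_eq:
  "genideal mpol_ring (range var) = (monomial_span {a. a \<noteq> 0} :: ('n::finite, 'k::field) mpol set)"
proof -
  have "range var = (monomial ` range (\<lambda>i. single i 1) :: ('n, 'k) mpol set)"
    by (auto simp: var_def)
  moreover have "upset_of (range (\<lambda>i. single i 1)) = {a :: 'n \<Rightarrow>\<^sub>0 nat. a \<noteq> 0}"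
  proof safe
    assume "(0 :: 'n \<Rightarrow>\<^sub>0 nat) \<in> upset_of (range (\<lambda>i. single i 1))"
    then obtain i :: 'n and c where "0 = single i (1::nat) + c" by (auto simp: upset_of_def sumset_def)
    from arg_cong[OF this, of "\<lambda>a. lookup a i"] show False by (simp add: lookup_add)
  next
    fix a :: "'n \<Rightarrow>\<^sub>0 nat" assume "a \<noteq> 0"
    then have "\<not> (\<forall>i. lookup a i = 0)" by (auto simp: poly_mapping_eq_iff fun_eq_iff)
    then obtain i where i: "lookup a i \<noteq> 0" by blast
    show "a \<in> upset_of (range (\<lambda>i. single i 1))"
    proof (rule upset_mono[OF upset_upset_of])
      show "single i 1 \<in> upset_of (range (\<lambda>i. single i 1))"
        using subset_upset_of by fast
      show "lookup (single i 1) k \<le> lookup a k" for k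
        using i by (auto simp: lookup_single when_def)
    qed
  qed
  ultimately show ?thesis by (simp add: genideal_monomials)
qed

section \<open>Chains of primes and the height of monomial ideals\<close>

text \<open>
  A coefficient of a product to which only one pair of monomials contributes. This replaces leading
  terms with respect to a monomial order.
\<close>

lemma lookup_mult_unique:
  fixes p q :: "('n::finite, 'k::field) mpol"
  assumes "\<And>a b. a \<in> keys p \<Longrightarrow> b \<in> keys q \<Longrightarrow> a + b = a0 + b0 \<Longrightarrow> a = a0"
  shows "lookup (p * q) (a0 + b0) = lookup p a0 * lookup q b0"
proof -
  have "lookup p a * (\<Sum>b. lookup q b when a0 + b0 = a + b) = (lookup p a0 * lookup q b0 when a = a0)" for a
  proof (cases "a = a0")
    case True
    then have "(\<lambda>b. lookup q b when a0 + b0 = a + b) = (\<lambda>b. lookup q b when b0 = b)" by auto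
    then show ?thesis using True by simp
  next
    case False
    have "lookup p a = 0" if nz: "(\<Sum>b. lookup q b when a0 + b0 = a + b) \<noteq> 0"
    proof -
      obtain b where "(lookup q b when a0 + b0 = a + b) \<noteq> 0"
        using Sum_any.not_neutral_obtains_not_neutral[OF nz] by blast
      then have "lookup q b \<noteq> 0" "a0 + b0 = a + b" by (auto simp: when_def split: if_splits)
      then show "lookup p a = 0" using assms[of a b] False by (auto simp: in_keys_iff)
    qed
    then show ?thesis using False by auto
  qed
  then show ?thesis by (simp add: lookup_mult)
qed

text \<open>
  Modulo all variables except \<open>x\<^sub>i\<close> the ring becomes \<open>K[x\<^sub>i]\<close>, a domain. Concretely: if \<open>x\<^sub>i\<^sup>m\<close> and \<open>x\<^sub>i\<^sup>l\<close>
  are the lowest powers of \<open>x\<^sub>i\<close> that occur in \<open>p\<close> and \<open>q\<close>, then \<open>x\<^sub>i\<^sup>m\<^sup>+\<^sup>l\<close> occurs in \<open>p q\<close>.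
\<close>

lemma coordinate_prime:
  "primeideal (monomial_span {a. \<exists>j. j \<noteq> i \<and> lookup a j \<noteq> 0} :: ('n::finite, 'k::field) mpol set) mpol_ring"
  (is "primeideal (monomial_span ?E) _")
  unfolding primeideal_ring_of_type_algebra_iff
proof (intro conjI allI impI)
  have "upset ?E" by (auto simp: upset_def lookup_add)
  then show "ideal (monomial_span ?E :: ('n, 'k) mpol set) mpol_ring" by (rule monomial_span_ideal)
  show "1 \<notin> (monomial_span ?E :: ('n, 'k) mpol set)" by (simp add: monomial_span_one_iff)
  have pure: "a = single i (lookup a i)" if "a \<notin> ?E" for a
  proof (rule poly_mapping_eqI)
    show "lookup a k = lookup (single i (lookup a i)) k" for k
      using that by (cases "k = i") (auto simp: lookup_single when_def)
  qed
  have least: "\<exists>m. single i m \<in> keys p \<and> (\<forall>l<m. single i l \<notin> keys p)"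
    if "p \<notin> monomial_span ?E" for p :: "('n, 'k) mpol"
  proof -
    obtain a where a: "a \<in> keys p" "a \<notin> ?E" using \<open>p \<notin> monomial_span ?E\<close> by (auto simp: monomial_span_def)
    have "single i (lookup a i) \<in> keys p"
      by (subst pure[OF a(2), symmetric]) (rule a(1))
    then show ?thesis using exists_least_iff[of "\<lambda>m. single i m \<in> keys p"] by blast
  qed
  fix p q :: "('n, 'k) mpol"
  assume pq: "p * q \<in> monomial_span ?E"
  show "p \<in> monomial_span ?E \<or> q \<in> monomial_span ?E"
  proof (rule ccontr)
    assume "\<not> (p \<in> monomial_span ?E \<or> q \<in> monomial_span ?E)"
    then obtain m l where m: "single i m \<in> keys p" "\<forall>m'<m. single i m' \<notin> keys p"
      and l: "single i l \<in> keys q" "\<forall>l'<l. single i l' \<notin> keys q"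
      using least[of p] least[of q] by blast
    have "lookup (p * q) (single i m + single i l) = lookup p (single i m) * lookup q (single i l)"
    proof (rule lookup_mult_unique)
      fix a b assume ab: "a \<in> keys p" "b \<in> keys q" "a + b = single i m + single i l"
      from ab(3) have *: "a + b = single i (m + l)" by (simp add: single_add)
      note s = add_eq_single[OF *]
      have "single i (lookup a i) \<in> keys p" by (subst s(1)[symmetric]) (rule ab(1))
      then have "m \<le> lookup a i" using m(2) by (meson not_le)
      moreover have "single i (lookup b i) \<in> keys q" by (subst s(2)[symmetric]) (rule ab(2))
      then have "l \<le> lookup b i" using l(2) by (meson not_le)
      ultimately have "lookup a i = m" using s(3) by simp
      then show "a = single i m" using s(1) by (simp only:)
    qed
    then have "lookup (p * q) (single i (m + l)) \<noteq> 0"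
      using m(1) l(1) by (simp add: single_add in_keys_iff)
    then have "single i (m + l) \<in> ?E" using pq unfolding monomial_span_def by (auto simp: in_keys_iff)
    then show False by (auto simp: lookup_single)
  qed
qed

lemma vector_space_mpol:
  "vector_space (\<lambda>c p. const c * p :: ('n::finite, 'k::field) mpol)"
  by unfold_locales (simp_all add: const_add const_mult algebra_simps)

text \<open>
  A family of vectors may repeat a vector, and a repetition already gives a relation; otherwise its
  image is too large to be independent.
\<close>

lemma (in vector_space) family_dependent:
  assumes "finite I" "finite B" "v ` I \<subseteq> span B" "card B < card I"
  obtains c where "\<exists>e\<in>I. c e \<noteq> 0" "(\<Sum>e\<in>I. scale (c e) (v e)) = 0"
proof (cases "inj_on v I")
  case True
  have "dependent (v ` I)"
  proof (rule ccontr)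
    assume "independent (v ` I)"
    then have "card (v ` I) \<le> card B" using independent_span_bound assms by blast
    then show False using assms(4) card_image[OF True] by simp
  qed
  then obtain u where u: "(\<exists>w\<in>v ` I. u w \<noteq> 0) \<and> (\<Sum>w\<in>v ` I. scale (u w) w) = 0"
    unfolding dependent_finite[OF finite_imageI[OF assms(1)]] by (rule exE)
  show ?thesis
  proof (rule that[of "\<lambda>e. u (v e)"])
    show "\<exists>e\<in>I. u (v e) \<noteq> 0" using u by blast
    show "(\<Sum>e\<in>I. scale (u (v e)) (v e)) = 0" using u by (simp add: sum.reindex[OF True])
  qed
next
  case False
  then obtain e f where ef: "e \<in> I" "f \<in> I" "e \<noteq> f" "v e = v f" by (auto simp: inj_on_def)
  define c :: "'c \<Rightarrow> 'a" where "c x = (if x = e then 1 else 0) - (if x = f then 1 else 0)" for x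
  have "(\<Sum>x\<in>I. scale (c x) (v x)) = (\<Sum>x\<in>I. (if x = e then v x else 0) - (if x = f then v x else 0))"
    by (intro sum.cong) (auto simp: c_def scale_left_diff_distrib)
  also have "\<dots> = 0" using ef assms(1) by (simp add: sum_subtractf sum.delta)
  finally show ?thesis using ef by (intro that[of c]) (auto simp: c_def intro!: bexI[of _ e])
qed

definition exponent_box :: "nat \<Rightarrow> ('n \<Rightarrow>\<^sub>0 nat) set" where
  "exponent_box d = {a. \<forall>i. lookup a i \<le> d}"

lemma exponent_box_mono: "d \<le> d' \<Longrightarrow> exponent_box d \<subseteq> exponent_box d'"
  by (auto simp: exponent_box_def intro: order_trans)

lemma card_exponent_box:
  "finite (exponent_box d :: ('n::finite \<Rightarrow>\<^sub>0 nat) set)" "card (exponent_box d :: ('n \<Rightarrow>\<^sub>0 nat) set) \<le> (d + 1) ^ CARD('n)"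
proof -
  have sub: "lookup ` (exponent_box d :: ('n \<Rightarrow>\<^sub>0 nat) set) \<subseteq> (\<Pi>\<^sub>E i\<in>UNIV. {..d})"
    by (auto simp: exponent_box_def)
  have fin: "finite (\<Pi>\<^sub>E i\<in>(UNIV :: 'n set). {..d})" by (intro finite_PiE) auto
  have inj: "inj_on lookup (exponent_box d :: ('n \<Rightarrow>\<^sub>0 nat) set)"
    by (simp add: inj_on_def poly_mapping_eqI)
  show "finite (exponent_box d :: ('n \<Rightarrow>\<^sub>0 nat) set)"
    using finite_subset[OF sub fin] inj by (rule finite_imageD)
  have "card (exponent_box d :: ('n \<Rightarrow>\<^sub>0 nat) set) = card (lookup ` (exponent_box d :: ('n \<Rightarrow>\<^sub>0 nat) set))"
    by (rule card_image[OF inj, symmetric])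
  also have "\<dots> \<le> card (\<Pi>\<^sub>E i\<in>(UNIV :: 'n set). {..d})" by (rule card_mono[OF fin sub])
  also have "\<dots> = (d + 1) ^ CARD('n)" by (simp add: card_PiE)
  finally show "card (exponent_box d :: ('n \<Rightarrow>\<^sub>0 nat) set) \<le> (d + 1) ^ CARD('n)" .
qed

lemma monomial_span_exponent_box_mult:
  assumes "p \<in> monomial_span (exponent_box d)" "q \<in> monomial_span (exponent_box d')"
  shows "p * q \<in> monomial_span (exponent_box (d + d'))"
proof -
  have "sumset (exponent_box d) (exponent_box d') \<subseteq> exponent_box (d + d')"
    by (auto simp: sumset_def exponent_box_def lookup_add) (simp add: add_mono)
  then show ?thesis using monomial_span_mult[OF assms] monomial_span_mono by blast
qed

lemma monomial_span_exponent_box_power: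
  assumes "p \<in> monomial_span (exponent_box d)"
  shows "p ^ k \<in> monomial_span (exponent_box (k * d))"
proof (induction k)
  case 0
  then show ?case by (simp add: monomial_span_def exponent_box_def)
next
  case (Suc k)
  then show ?case using monomial_span_exponent_box_mult[OF assms Suc] by simp
qed

lemma monomial_span_exponent_box_prod:
  assumes "finite I" "\<And>i. i \<in> I \<Longrightarrow> f i \<in> monomial_span (exponent_box (d i))"
  shows "prod f I \<in> monomial_span (exponent_box (sum d I))"
  using assms
proof (induction I)
  case empty
  then show ?case by (simp add: monomial_span_def exponent_box_def)
next
  case (insert i I)
  then show ?case using monomial_span_exponent_box_mult[of "f i" "d i" "prod f I" "sum d I"] by simp
qed

lemma monomial_span_exponent_box_exists: "\<exists>d. p \<in> monomial_span (exponent_box d)"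
proof -
  define d where "d = (\<Sum>a\<in>keys p. \<Sum>i\<in>UNIV. lookup a i)"
  have "lookup a i \<le> d" if "a \<in> keys p" for a i
  proof -
    have "lookup a i \<le> (\<Sum>i\<in>UNIV. lookup a i)" by (rule member_le_sum) auto
    also have "\<dots> \<le> d" unfolding d_def using that by (intro member_le_sum) auto
    finally show ?thesis .
  qed
  then show ?thesis by (auto simp: monomial_span_def exponent_box_def)
qed

text \<open>
  A counting argument: the products of powers of \<open>y\<^sub>0, \<dots>, y\<^sub>n\<close> with all exponents below \<open>N\<close> number
  \<open>N\<^bsup>n+1\<^esup>\<close>, but they lie in a space spanned by at most \<open>(N D + 1)\<^sup>n\<close> monomials, where \<open>D\<close> depends
  only on the \<open>y\<^sub>j\<close>. For large \<open>N\<close> the second number is smaller.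
\<close>

lemma algebraic_dependence:
  fixes y :: "nat \<Rightarrow> ('n::finite, 'k::field) mpol"
  defines "n \<equiv> CARD('n)"
  obtains E c where "finite E" "E \<noteq> {}" "E \<subseteq> extensional {..n}" "\<And>e. e \<in> E \<Longrightarrow> c e \<noteq> (0 :: 'k)"
    "(\<Sum>e\<in>E. const (c e) * (\<Prod>j\<in>{..n}. y j ^ e j)) = 0"
proof -
  interpret vector_space "\<lambda>c p. const c * p :: ('n, 'k) mpol" by (rule vector_space_mpol)
  obtain d where d: "\<forall>j. y j \<in> monomial_span (exponent_box (d j))"
    using choice[of "\<lambda>j d. y j \<in> monomial_span (exponent_box d)"] monomial_span_exponent_box_exists by blast
  define D where "D = (\<Sum>j\<in>{..n}. d j)"
  \<comment> \<open>\<open>N > M\<^sup>n\<close> gives \<open>(N M)\<^sup>n < N\<^bsup>n+1\<^esup>\<close>, and \<open>N D + 1 \<le> N M\<close>.\<close>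
  define M where "M = Suc D"
  define N where "N = M ^ n + 1"
  define F where "F = (\<Pi>\<^sub>E j\<in>{..n}. {..<N})"
  define v where "v e = (\<Prod>j\<in>{..n}. y j ^ e j)" for e :: "nat \<Rightarrow> nat"
  have "v e \<in> monomial_span (exponent_box (N * D))" if "e \<in> F" for e
  proof -
    have "v e \<in> monomial_span (exponent_box (\<Sum>j\<in>{..n}. e j * d j))"
      unfolding v_def using d by (intro monomial_span_exponent_box_prod monomial_span_exponent_box_power) auto
    moreover have "(\<Sum>j\<in>{..n}. e j * d j) \<le> N * D"
      unfolding D_def sum_distrib_left
      using that by (intro sum_mono mult_right_mono) (auto simp: F_def dest!: PiE_mem)
    ultimately show ?thesis using monomial_span_mono[OF exponent_box_mono] by blast
  qed
  moreover have "p \<in> span (monomial ` exponent_box m)" if "p \<in> monomial_span (exponent_box m)" for p :: "('n, 'k) mpol" and m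
  proof -
    have "(\<Sum>a\<in>keys p. const (lookup p a) * monomial a) \<in> span (monomial ` exponent_box m)"
      using that by (intro span_sum span_scale span_base) (auto simp: monomial_span_def)
    then show ?thesis by (simp flip: mpol_expansion)
  qed
  ultimately have sub: "v ` F \<subseteq> span (monomial ` exponent_box (N * D))" by blast
  have "card (monomial ` exponent_box (N * D) :: ('n, 'k) mpol set) \<le> card (exponent_box (N * D) :: ('n \<Rightarrow>\<^sub>0 nat) set)"
    by (rule card_image_le[OF card_exponent_box(1)])
  also have "\<dots> \<le> (N * D + 1) ^ n" unfolding n_def by (rule card_exponent_box(2))
  also have "\<dots> \<le> (N * M) ^ n" by (intro power_mono) (simp_all add: M_def N_def)
  also have "\<dots> = N ^ n * M ^ n" by (rule power_mult_distrib)
  also have "\<dots> < N ^ n * N" unfolding N_def by (intro mult_strict_left_mono) simp_all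
  also have "\<dots> = card F" by (simp add: F_def card_PiE)
  finally have less: "card (monomial ` exponent_box (N * D) :: ('n, 'k) mpol set) < card F" .
  have finF: "finite F" unfolding F_def by (intro finite_PiE) auto
  obtain c where c: "\<exists>e\<in>F. c e \<noteq> 0" "(\<Sum>e\<in>F. const (c e) * v e) = 0"
    using family_dependent[OF finF finite_imageI[OF card_exponent_box(1)] sub less] by blast
  show ?thesis
  proof (rule that[of "{e\<in>F. c e \<noteq> 0}" c])
    have "(\<Sum>e | e \<in> F \<and> c e \<noteq> 0. const (c e) * v e) = (\<Sum>e\<in>F. const (c e) * v e)"
      using finF by (intro sum.mono_neutral_left) auto
    then show "(\<Sum>e | e \<in> F \<and> c e \<noteq> 0. const (c e) * (\<Prod>j\<in>{..n}. y j ^ e j)) = 0"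
      using c(2) by (simp add: v_def)
    show "finite {e\<in>F. c e \<noteq> 0}" using finF by simp
    show "{e\<in>F. c e \<noteq> 0} \<noteq> {}" using c(1) by blast
    show "{e\<in>F. c e \<noteq> 0} \<subseteq> extensional {..n}" unfolding F_def PiE_def by blast
  qed simp
qed

text \<open>
  Choose \<open>y\<^sub>j\<close> in \<open>P\<^sub>j\<^sub>+\<^sub>1\<close> but not in \<open>P\<^sub>j\<close>, and a nontrivial relation between \<open>y\<^sub>0, \<dots>, y\<^sub>n\<close>. Its terms of lowest
  degree in \<open>y\<^sub>0\<close>, divided by that power of \<open>y\<^sub>0\<close>, give an element that differs from an element
  of the prime \<open>P\<^sub>0\<close> by a multiple of \<open>y\<^sub>0\<close>, and hence lies in \<open>P\<^sub>1\<close>. Repeating this with \<open>y\<^sub>1, \<dots>, y\<^sub>n\<close> leads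
  to a single term, a nonzero constant, in \<open>P\<^sub>n\<^sub>+\<^sub>1\<close>.
\<close>

lemma no_long_prime_chain:
  fixes P :: "nat \<Rightarrow> ('n::finite, 'k::field) mpol set"
  defines "n \<equiv> CARD('n)"
  assumes prime: "\<And>j. j \<le> n \<Longrightarrow> primeideal (P j) mpol_ring"
    and top: "ideal (P (Suc n)) mpol_ring" "1 \<notin> P (Suc n)"
    and chain: "\<And>j. j \<le> n \<Longrightarrow> P j \<subset> P (Suc j)"
  shows False
proof -
  have "\<exists>x. x \<in> P (Suc j) - P j" if "j \<le> n" for j using chain[OF that] by blast
  then obtain y where y: "\<And>j. j \<le> n \<Longrightarrow> y j \<in> P (Suc j) - P j" by metis
  obtain E c where E: "finite E" "E \<noteq> {}" "E \<subseteq> extensional {..n}" "\<And>e. e \<in> E \<Longrightarrow> c e \<noteq> (0 :: 'k)"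
    "(\<Sum>e\<in>E. const (c e) * (\<Prod>j\<in>{..n}. y j ^ e j)) = 0"
    using algebraic_dependence[of y] unfolding n_def by blast
  define T where "T j e = const (c e) * (\<Prod>i\<in>{j..n}. y i ^ e i)" for j e
  have ideal: "ideal (P j) mpol_ring" if "j \<le> Suc n" for j
    using that prime[of j] top(1) by (cases "j = Suc n") (auto simp: primeideal_ring_of_type_algebra_iff)
  have "\<exists>F\<subseteq>E. F \<noteq> {} \<and> (\<forall>e\<in>F. \<forall>f\<in>F. \<forall>i<j. e i = f i) \<and> (\<Sum>e\<in>F. T j e) \<in> P j"
    if "j \<le> Suc n" for j
    using that
  proof (induction j)
    case 0
    have "{0..n} = {..n}" by auto
    then have "(\<Sum>e\<in>E. T 0 e) = 0" using E(5) by (simp add: T_def)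
    then show ?case using E(2) ideal[of 0]
      by (intro exI[of _ E]) (simp add: ideal_ring_of_type_algebra_iff)
  next
    case (Suc j)
    then obtain F where F: "F \<subseteq> E" "F \<noteq> {}" "\<forall>e\<in>F. \<forall>f\<in>F. \<forall>i<j. e i = f i" "(\<Sum>e\<in>F. T j e) \<in> P j"
      by auto
    have finF: "finite F" using F(1) E(1) finite_subset by blast
    define m where "m = Min ((\<lambda>e. e j) ` F)"
    define G where "G = {e\<in>F. e j = m}"
    have m_le: "m \<le> e j" if "e \<in> F" for e using that finF by (simp add: m_def)
    have "m \<in> (\<lambda>e. e j) ` F" unfolding m_def using finF F(2) by (intro Min_in) auto
    then have G: "G \<subseteq> F" "G \<noteq> {}" by (auto simp: G_def)
    have T: "T j e = y j ^ e j * T (Suc j) e" for e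
      using Suc.prems by (simp add: T_def atLeastAtMost_insertL[symmetric, of j n] mult.left_commute)
    \<comment> \<open>In the terms outside \<open>G\<close> a further factor \<open>y j\<close> can be split off.\<close>
    define W where "W = (\<Sum>e\<in>F - G. y j ^ (e j - m - 1) * T (Suc j) e)"
    have "(\<Sum>e\<in>F. T j e) = (\<Sum>e\<in>G. T j e) + (\<Sum>e\<in>F - G. T j e)"
      using sum.subset_diff[OF G(1) finF, of "T j"] by (simp add: add.commute)
    also have "(\<Sum>e\<in>G. T j e) = y j ^ m * (\<Sum>e\<in>G. T (Suc j) e)"
      unfolding sum_distrib_left by (intro sum.cong) (auto simp: T G_def)
    also have "(\<Sum>e\<in>F - G. T j e) = y j ^ m * (y j * W)"
      unfolding W_def sum_distrib_left
    proof (intro sum.cong refl)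
      fix e assume e: "e \<in> F - G"
      then have "m < e j" using m_le[of e] by (auto simp: G_def)
      then have "e j = m + Suc (e j - m - 1)" by simp
      then have "y j ^ e j = y j ^ m * (y j * y j ^ (e j - m - 1))"
        by (metis power_add power_Suc)
      then show "T j e = y j ^ m * (y j * (y j ^ (e j - m - 1) * T (Suc j) e))"
        by (simp add: T mult.assoc)
    qed
    finally have "y j ^ m * ((\<Sum>e\<in>G. T (Suc j) e) + y j * W) \<in> P j"
      using F(4) by (simp add: distrib_left)
    moreover have "y j ^ m \<notin> P j"
      using primeideal_power[OF prime[of j]] y[of j] Suc.prems by auto
    ultimately have "(\<Sum>e\<in>G. T (Suc j) e) + y j * W \<in> P j"
      using prime[of j] Suc.prems by (auto simp: primeideal_ring_of_type_algebra_iff)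
    then have "(\<Sum>e\<in>G. T (Suc j) e) + y j * W \<in> P (Suc j)" using chain[of j] Suc.prems by auto
    moreover have "W * y j \<in> P (Suc j)"
      using y[of j] Suc.prems ideal[of "Suc j"] by (simp add: ideal_ring_of_type_algebra_iff)
    ultimately have "(\<Sum>e\<in>G. T (Suc j) e) \<in> P (Suc j)"
      using ideal_diff[OF ideal[OF Suc.prems], of "(\<Sum>e\<in>G. T (Suc j) e) + y j * W" "W * y j"]
      by (simp add: mult.commute)
    moreover have "e i = f i" if "e \<in> G" "f \<in> G" "i < Suc j" for e f i
      using that F(3) G(1) by (cases "i = j") (auto simp: G_def less_Suc_eq)
    ultimately show ?case using G F(1) by (intro exI[of _ G]) auto
  qed
  from this[of "Suc n"] obtain F where F: "F \<subseteq> E" "F \<noteq> {}" "\<forall>e\<in>F. \<forall>f\<in>F. \<forall>i<Suc n. e i = f i"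
    "(\<Sum>e\<in>F. T (Suc n) e) \<in> P (Suc n)" by auto
  obtain e where e: "e \<in> F" using F(2) by blast
  have "f = e" if "f \<in> F" for f
  proof (rule extensionalityI[of _ "{..n}"])
    show "f \<in> extensional {..n}" "e \<in> extensional {..n}" using that e F(1) E(3) by auto
    show "f i = e i" if "i \<in> {..n}" for i using F(3) \<open>f \<in> F\<close> e that by (simp add: less_Suc_eq_le)
  qed
  then have "F = {e}" using e by blast
  then have "const (c e) \<in> P (Suc n)" using F(4) by (simp add: T_def)
  then have "const (inverse (c e)) * const (c e) \<in> P (Suc n)"
    using top(1) unfolding ideal_ring_of_type_algebra_iff by blast
  moreover have "c e \<noteq> 0" using E(4) F(1) e by blast
  ultimately show False using top(2) by (simp flip: const_mult)
qed

text \<open>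
  A chain of length \<open>n\<close> ending in this prime could be prolonged by the ideal of all variables.
\<close>

lemma prime_height_coordinate_prime:
  fixes i :: "'n::finite"
  shows "prime_height mpol_ring (monomial_span {a. \<exists>j. j \<noteq> i \<and> lookup a j \<noteq> 0} :: ('n, 'k::field) mpol set) < enat CARD('n)"
    (is "prime_height _ ?Q < _")
proof -
  have "k \<le> CARD('n) - 1" if chain: "prime_chain mpol_ring k P" "P k = ?Q" for k P
  proof (rule ccontr)
    define n where "n = CARD('n)"
    assume "\<not> k \<le> CARD('n) - 1"
    then have "n \<le> k" unfolding n_def by simp
    \<comment> \<open>The last \<open>n + 1\<close> members of the chain, followed by the maximal ideal.\<close>
    define P' where "P' j = (if j \<le> n then P (k - n + j) else monomial_span {a. a \<noteq> 0})" for j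
    have "?Q \<subset> monomial_span {a. a \<noteq> 0}"
    proof (rule psubsetI)
      show "?Q \<subseteq> monomial_span {a. a \<noteq> 0}" by (rule monomial_span_mono) auto
      have "single i (1 :: nat) \<noteq> 0" by (simp add: poly_mapping_eq_iff fun_eq_iff lookup_single when_def)
      then have "monomial (single i 1) \<in> (monomial_span {a. a \<noteq> 0} :: ('n, 'k) mpol set)" by simp
      moreover have "monomial (single i 1) \<notin> ?Q" by (auto simp: lookup_single when_def split: if_splits)
      ultimately show "?Q \<noteq> monomial_span {a. a \<noteq> 0}" by blast
    qed
    then have "P' j \<subset> P' (Suc j)" if "j \<le> n" for j
      using chain that \<open>n \<le> k\<close> by (cases "j = n") (auto simp: P'_def prime_chain_def)
    moreover have "primeideal (P' j) mpol_ring" if "j \<le> n" for j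
      using chain that \<open>n \<le> k\<close> by (auto simp: P'_def prime_chain_def)
    moreover have "ideal (P' (Suc n)) mpol_ring" "1 \<notin> P' (Suc n)"
      by (auto simp: P'_def monomial_span_one_iff upset_def poly_mapping_eq_iff fun_eq_iff lookup_add intro!: monomial_span_ideal)
    ultimately show False using no_long_prime_chain[of P'] unfolding n_def by blast
  qed
  then have "prime_height mpol_ring ?Q \<le> enat (CARD('n) - 1)"
    unfolding prime_height_def by (intro Sup_least) auto
  also have "\<dots> < enat CARD('n)" by simp
  finally show ?thesis .
qed

text \<open>
  A monomial ideal without powers of \<open>x\<^sub>i\<close> lies in the prime ideal generated by the other variables,
  which has too small a height; the unit ideal has height \<open>\<infinity>\<close>.
\<close>

lemma monomial_ideal_full_height:
  fixes E :: "('n::finite \<Rightarrow>\<^sub>0 nat) set"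
  assumes "upset E" "ideal_height mpol_ring (monomial_span E :: ('n, 'k::field) mpol set) = enat CARD('n)"
  shows "pure_powers E" "0 \<notin> E"
proof -
  show "pure_powers E"
  proof (rule ccontr)
    assume "\<not> pure_powers E"
    then obtain i where i: "\<And>c. single i c \<notin> E" unfolding pure_powers_def by blast
    let ?Q = "monomial_span {a. \<exists>j. j \<noteq> i \<and> lookup a j \<noteq> 0} :: ('n, 'k) mpol set"
    have "E \<subseteq> {a. \<exists>j. j \<noteq> i \<and> lookup a j \<noteq> 0}"
    proof safe
      fix a assume a: "a \<in> E"
      show "\<exists>j. j \<noteq> i \<and> lookup a j \<noteq> 0"
      proof (rule ccontr)
        assume "\<nexists>j. j \<noteq> i \<and> lookup a j \<noteq> 0"
        then have "a = single i (lookup a i)"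
          by (auto simp: poly_mapping_eq_iff fun_eq_iff lookup_single when_def)
        then show False using i[of "lookup a i"] a by argo
      qed
    qed
    then have "monomial_span E \<subseteq> ?Q" by (rule monomial_span_mono)
    then have "ideal_height mpol_ring (monomial_span E :: ('n, 'k) mpol set) \<le> prime_height mpol_ring ?Q"
      unfolding ideal_height_def using coordinate_prime[of i] by (intro Inf_lower) blast
    also have "\<dots> < enat CARD('n)" by (rule prime_height_coordinate_prime)
    finally show False using assms(2) by simp
  qed
  show "0 \<notin> E"
  proof
    assume "0 \<in> E"
    then have "(monomial_span E :: ('n, 'k) mpol set) = UNIV"
      using ideal_eq_UNIV[OF monomial_span_ideal[OF assms(1)]] monomial_span_one_iff by blast
    then have "ideal_height mpol_ring (monomial_span E :: ('n, 'k) mpol set) = Inf {}"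
      unfolding ideal_height_def primeideal_ring_of_type_algebra_iff by (intro arg_cong[where f = Inf]) auto
    then show False using assms(2) by (simp add: top_enat_def)
  qed
qed

section \<open>Residue class modules\<close>

text \<open>
  The coset \<open>L + p\<close> without reference to a ring structure, so that the simplifier can compute in
  quotient modules.
\<close>

definition residue_class :: "'a::comm_ring_1 set \<Rightarrow> 'a \<Rightarrow> 'a set" where
  "residue_class L p = (\<lambda>l. l + p) ` L"

lemma residue_class_eq_iff:
  fixes L :: "'a::comm_ring_1 set"
  assumes "ideal L ring_of_type_algebra"
  shows "residue_class L p = residue_class L q \<longleftrightarrow> p - q \<in> L"
proof
  have 0: "0 \<in> L" using assms by (simp add: ideal_ring_of_type_algebra_iff)
  assume "residue_class L p = residue_class L q"
  moreover have "p \<in> residue_class L p" using 0 by (force simp: residue_class_def)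
  ultimately obtain l where "l \<in> L" "p = l + q" by (auto simp: residue_class_def)
  then show "p - q \<in> L" by simp
next
  have *: "residue_class L p \<subseteq> residue_class L q" if "p - q \<in> L" for p q
  proof
    fix x assume "x \<in> residue_class L p"
    then obtain l where "l \<in> L" "x = l + p" by (auto simp: residue_class_def)
    then have "l + (p - q) \<in> L" "x = (l + (p - q)) + q"
      using that assms by (simp_all add: ideal_ring_of_type_algebra_iff)
    then show "x \<in> residue_class L q" unfolding residue_class_def by blast
  qed
  assume "p - q \<in> L"
  moreover have "0 - (p - q) \<in> L"
    using ideal_diff[OF assms _ \<open>p - q \<in> L\<close>, of 0] assms by (simp add: ideal_ring_of_type_algebra_iff)
  ultimately show "residue_class L p = residue_class L q" using *[of p q] *[of q p] by simp
qed

lemma residue_class_0 [simp]: "residue_class L 0 = L"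
  by (simp add: residue_class_def)

lemma residue_class_eq_self_iff:
  fixes L :: "'a::comm_ring_1 set"
  assumes "ideal L ring_of_type_algebra"
  shows "residue_class L p = L \<longleftrightarrow> p \<in> L"
  using residue_class_eq_iff[OF assms, of p 0] by simp

lemma quot_by_ideal_simps:
  fixes L :: "('n::finite, 'k::field) mpol set"
  assumes "ideal L mpol_ring"
  shows "carrier (quot_by_ideal L) = range (residue_class L)"
    and "\<zero>\<^bsub>quot_by_ideal L\<^esub> = L"
    and "residue_class L p \<oplus>\<^bsub>quot_by_ideal L\<^esub> residue_class L q = residue_class L (p + q)"
    and "r \<odot>\<^bsub>quot_by_ideal L\<^esub> residue_class L p = residue_class L (r * p)"
proof -
  have L: "0 \<in> L" "x + y \<in> L" "s * x \<in> L" if "x \<in> L" "y \<in> L" for x y s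
    using assms that by (simp_all add: ideal_ring_of_type_algebra_iff)
  have 0: "0 \<in> L" using assms by (simp add: ideal_ring_of_type_algebra_iff)
  have coset: "L +>\<^bsub>regular_module mpol_ring\<^esub> x = residue_class L x" for x
    by (auto simp: a_r_coset_def r_coset_def residue_class_def regular_module_def)
  show "carrier (quot_by_ideal L) = range (residue_class L)"
    by (auto simp: quot_by_ideal_def quot_module_def A_RCOSETS_def RCOSETS_def r_coset_def
        regular_module_def residue_class_def)
  show "\<zero>\<^bsub>quot_by_ideal L\<^esub> = L"
    by (simp add: quot_by_ideal_def quot_module_def)
  show "residue_class L p \<oplus>\<^bsub>quot_by_ideal L\<^esub> residue_class L q = residue_class L (p + q)"
  proof -
    have "residue_class L p \<oplus>\<^bsub>quot_by_ideal L\<^esub> residue_class L q = {l + p + (l' + q) | l l'. l \<in> L \<and> l' \<in> L}"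
      by (auto simp: quot_by_ideal_def quot_module_def set_add_def set_mult_def regular_module_def residue_class_def)
    also have "\<dots> = residue_class L (p + q)"
    proof (intro equalityI subsetI)
      fix x assume "x \<in> {l + p + (l' + q) | l l'. l \<in> L \<and> l' \<in> L}"
      then obtain l l' where "l \<in> L" "l' \<in> L" "x = (l + l') + (p + q)" by (auto simp: algebra_simps)
      then show "x \<in> residue_class L (p + q)" using L unfolding residue_class_def by blast
    next
      fix x assume "x \<in> residue_class L (p + q)"
      then obtain l where "l \<in> L" "x = l + p + (0 + q)" by (auto simp: residue_class_def algebra_simps)
      then show "x \<in> {l + p + (l' + q) | l l'. l \<in> L \<and> l' \<in> L}" using 0 by blast
    qed
    finally show ?thesis .
  qed
  show "r \<odot>\<^bsub>quot_by_ideal L\<^esub> residue_class L p = residue_class L (r * p)"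
  proof -
    have "r \<odot>\<^bsub>quot_by_ideal L\<^esub> residue_class L p = (\<Union>l\<in>L. residue_class L (r * (l + p)))"
      by (simp add: quot_by_ideal_def quot_module_def coset) (simp add: regular_module_def residue_class_def)
    also have "\<dots> = (\<Union>l\<in>L. residue_class L (r * p))"
    proof (intro SUP_cong refl)
      fix l assume "l \<in> L"
      then show "residue_class L (r * (l + p)) = residue_class L (r * p)"
        using residue_class_eq_iff[OF assms, of "r * (l + p)" "r * p"] L by (simp add: algebra_simps)
    qed
    also have "\<dots> = residue_class L (r * p)" using 0 by auto
    finally show ?thesis .
  qed
qed

section \<open>Krull dimension zero\<close>

text \<open>
  Modulo the ideal of all variables, an element is congruent to its constant term, which is
  invertible if it is not zero.
\<close>

lemma maximal_ideal_maximal: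
  fixes P :: "('n::finite, 'k::field) mpol set"
  assumes "ideal P mpol_ring" "1 \<notin> P" "monomial_span {a. a \<noteq> 0} \<subseteq> P"
  shows "P = monomial_span {a. a \<noteq> 0}"
proof (rule ccontr)
  assume "P \<noteq> monomial_span {a. a \<noteq> 0}"
  then obtain p where p: "p \<in> P" "p \<notin> monomial_span {a. a \<noteq> 0}" using assms(3) by blast
  then have c: "lookup p 0 \<noteq> 0" by (auto simp: monomial_span_def in_keys_iff)
  have "p - const (lookup p 0) \<in> monomial_span {a. a \<noteq> 0}"
    by (auto simp: monomial_span_def in_keys_iff lookup_minus const_def)
  then have "p - (p - const (lookup p 0)) \<in> P" using ideal_diff[OF assms(1) p(1)] assms(3) by blast
  then have "const (lookup p 0) \<in> P" by simp
  then have "const (inverse (lookup p 0)) * const (lookup p 0) \<in> P"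
    using assms(1) unfolding ideal_ring_of_type_algebra_iff by blast
  then show False using c assms(2) by (simp flip: const_mult)
qed

text \<open>
  A prime ideal over \<open>L\<close> contains every variable, because it contains a power of it. So it is the
  maximal ideal \<open>(x\<^sub>1, \<dots>, x\<^sub>n)\<close>, and chains of such primes have length \<open>0\<close>.
\<close>

lemma krull_dim_eq_0:
  fixes E :: "('n::finite \<Rightarrow>\<^sub>0 nat) set"
  assumes "upset E" "pure_powers E"
  shows "module_krull_dim mpol_ring (quot_by_ideal (monomial_span E :: ('n, 'k::field) mpol set)) = 0"
proof -
  define L where "L = (monomial_span E :: ('n, 'k) mpol set)"
  have L: "ideal L mpol_ring" unfolding L_def by (rule monomial_span_ideal[OF assms(1)])
  note [simp] = quot_by_ideal_simps[OF L]
  have ann: "L \<subseteq> annihilator mpol_ring (quot_by_ideal L)"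
  proof
    fix r assume r: "r \<in> L"
    have "residue_class L (r * p) = L" for p
      using r L unfolding residue_class_eq_self_iff[OF L]
      by (simp add: ideal_ring_of_type_algebra_iff mult.commute[of r p])
    then show "r \<in> annihilator mpol_ring (quot_by_ideal L)" by (auto simp: annihilator_def)
  qed
  have "k = 0" if chain: "prime_chain mpol_ring k P" and P0: "L \<subseteq> P 0" for k P
  proof (rule ccontr)
    assume "k \<noteq> 0"
    have prime: "primeideal (P i) mpol_ring" if "i \<le> k" for i
      using chain that by (simp add: prime_chain_def)
    have "monomial a \<in> P 0" if a: "a \<in> range (\<lambda>i. single i 1)" for a
    proof -
      obtain i where i: "a = single i 1" using a by blast
      obtain c where "single i c \<in> E" using assms(2) by (auto simp: pure_powers_def)
      then have "monomial (single i c) \<in> P 0" using P0 by (auto simp: L_def)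
      then have "monomial a ^ c \<in> P 0" by (simp only: i monomial_power)
      then show ?thesis using primeideal_power[OF prime[of 0]] by simp
    qed
    then have "genideal mpol_ring (range var) \<subseteq> P 0"
      using prime[of 0] by (intro genideal_minimal) (auto simp: primeideal_ring_of_type_algebra_iff var_def)
    then have m: "monomial_span {a. a \<noteq> 0} \<subseteq> P 0" by (simp add: maximal_ideal_eq)
    have "P 0 \<subset> P 1" using chain \<open>k \<noteq> 0\<close> by (auto simp: prime_chain_def)
    moreover have "P i = monomial_span {a. a \<noteq> 0}" if "i = 0 \<or> i = 1" for i
      using that m \<open>P 0 \<subset> P 1\<close> prime[of i] \<open>k \<noteq> 0\<close>
      by (intro maximal_ideal_maximal) (auto simp: primeideal_ring_of_type_algebra_iff)
    ultimately show False by simp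
  qed
  then have "module_krull_dim mpol_ring (quot_by_ideal L) \<le> 0"
    unfolding module_krull_dim_def using ann by (intro Sup_least) (auto simp: zero_enat_def)
  then show ?thesis by (simp add: L_def)
qed

section \<open>Free resolutions by modules of countable rank\<close>

text \<open>
  The free module with basis \<open>e\<^sub>0, e\<^sub>1, \<dots>\<close>. A vector is multiplied by a scalar as by the constant
  polynomial in the ring structure of its type, so the module axioms follow from ring axioms.
\<close>

definition countable_free :: "('a::comm_ring_1, nat \<Rightarrow>\<^sub>0 'a) module" where
  "countable_free = \<lparr>carrier = UNIV, mult = undefined, one = undefined, zero = 0, add = (+),
     smult = (\<lambda>r f. single 0 r * f)\<rparr>"

lemma countable_free_simps [simp]:
  "carrier countable_free = UNIV" "\<zero>\<^bsub>countable_free\<^esub> = 0" "f \<oplus>\<^bsub>countable_free\<^esub> g = f + g" "r \<odot>\<^bsub>countable_free\<^esub> f = single 0 r * f"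
  by (simp_all add: countable_free_def)

lemma lookup_scale [simp]: "lookup (single 0 r * f) i = r * lookup f i"
  for f :: "nat \<Rightarrow>\<^sub>0 'a::comm_ring_1"
  by (simp flip: mult_map_scale_conv_mult add: Poly_Mapping.map.rep_eq when_def)

lemma module_countable_free: "module ring_of_type_algebra (countable_free :: ('a::comm_ring_1, nat \<Rightarrow>\<^sub>0 'a) module)"
proof (rule moduleI)
  show "abelian_group (countable_free :: ('a, nat \<Rightarrow>\<^sub>0 'a) module)"
  proof (rule abelian_groupI)
    fix x :: "nat \<Rightarrow>\<^sub>0 'a"
    show "\<exists>y\<in>carrier countable_free. y \<oplus>\<^bsub>countable_free\<^esub> x = \<zero>\<^bsub>countable_free\<^esub>"
      by (rule bexI[of _ "- x"]) simp_all
  qed (simp_all add: add_ac)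
qed (auto intro!: poly_mapping_eqI simp: lookup_add distrib_left distrib_right mult.assoc)

lemma finsum_countable_free: "finite A \<Longrightarrow> finsum countable_free g A = (sum g A :: nat \<Rightarrow>\<^sub>0 'a::comm_ring_1)"
proof (induction A rule: finite_induct)
  case empty
  interpret module ring_of_type_algebra "countable_free :: ('a, nat \<Rightarrow>\<^sub>0 'a) module" by (rule module_countable_free)
  show ?case by simp
next
  case (insert x A)
  interpret module ring_of_type_algebra "countable_free :: ('a, nat \<Rightarrow>\<^sub>0 'a) module" by (rule module_countable_free)
  show ?case using insert by (subst finsum_insert) auto
qed

lemma vector_expansion: "f = (\<Sum>j\<in>keys f. single 0 (lookup f j) * single j 1)"
  for f :: "nat \<Rightarrow>\<^sub>0 'a::comm_ring_1"
  by (rule poly_mapping_eqI)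
    (simp add: lookup_sum lookup_single when_def in_keys_iff sum.delta mult_single)

lemma free_module_countable_free: "free_module ring_of_type_algebra (countable_free :: ('a::comm_ring_1, nat \<Rightarrow>\<^sub>0 'a) module)"
proof -
  interpret module ring_of_type_algebra "countable_free :: ('a, nat \<Rightarrow>\<^sub>0 'a) module" by (rule module_countable_free)
  define e :: "nat \<Rightarrow> nat \<Rightarrow>\<^sub>0 'a" where "e j = single j 1" for j
  have inj: "inj e"
  proof (rule injI)
    fix i j assume "e i = e j"
    then have "lookup (e i) i = lookup (e j) i" by simp
    then show "i = j" by (auto simp: e_def lookup_single when_def split: if_splits)
  qed
  have lincomb: "lincomb a A = (\<Sum>v\<in>A. single 0 (a v) * v)" if "finite A" for a A
    using that by (simp add: lincomb_def finsum_countable_free)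
  have "\<not> lin_dep (range e)"
  proof
    assume "lin_dep (range e)"
    then obtain A a v where A: "finite A" "A \<subseteq> range e" "lincomb a A = 0" "v \<in> A" "a v \<noteq> 0"
      unfolding lin_dep_def by auto
    then obtain j where j: "v = e j" by blast
    have "(\<Sum>w\<in>A. a w * lookup w j) = (\<Sum>w\<in>A. if w = v then a v else 0)"
      using A(2) j inj by (intro sum.cong refl) (auto simp: e_def lookup_single when_def inj_eq)
    also have "\<dots> = a v" using A(1,4) by simp
    finally have "lookup (lincomb a A) j = a v"
      using A(1) by (simp add: lincomb lookup_sum)
    then show False using A(3,5) by simp
  qed
  moreover have "f \<in> span (range e)" for f
  proof -
    define a where "a v = lookup f (inv_into UNIV e v)" for v
    have a: "a (e j) = lookup f j" for j by (simp add: a_def inv_f_f[OF inj])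
    have "f = (\<Sum>j\<in>keys f. single 0 (a (e j)) * e j)"
      unfolding a unfolding e_def by (rule vector_expansion)
    also have "\<dots> = lincomb a (e ` keys f)"
      by (simp add: lincomb sum.reindex[OF inj_on_subset[OF inj subset_UNIV]])
    finally have "f = lincomb a (e ` keys f)" .
    moreover have "finite (e ` keys f)" "e ` keys f \<subseteq> range e" "a \<in> e ` keys f \<rightarrow> carrier ring_of_type_algebra"
      by auto
    ultimately show ?thesis unfolding span_def by blast
  qed
  ultimately show ?thesis
    unfolding free_module_def using module_countable_free by (intro conjI exI[of _ "range e"]) auto
qed

text \<open>
  The linear map that sends the \<open>j\<close>-th basis vector to \<open>w j\<close>.
\<close>

definition linear_extension :: "(nat \<Rightarrow> nat \<Rightarrow>\<^sub>0 'a) \<Rightarrow> (nat \<Rightarrow>\<^sub>0 'a) \<Rightarrow> (nat \<Rightarrow>\<^sub>0 'a::comm_ring_1)" where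
  "linear_extension w f = (\<Sum>j\<in>keys f. single 0 (lookup f j) * w j)"

lemma linear_extension_superset:
  assumes "finite S" "keys f \<subseteq> S"
  shows "linear_extension w f = (\<Sum>j\<in>S. single 0 (lookup f j) * w j)"
  unfolding linear_extension_def using assms by (intro sum.mono_neutral_left) (auto simp: in_keys_iff)

lemma linear_extension_add: "linear_extension w (f + g) = linear_extension w f + linear_extension w g"
proof -
  have "finite (keys f \<union> keys g)" "keys (f + g) \<subseteq> keys f \<union> keys g" using keys_add[of f g] by auto
  then show ?thesis
    by (simp add: linear_extension_superset[of "keys f \<union> keys g"] lookup_add single_add distrib_right sum.distrib)
qed

lemma linear_extension_scale: "linear_extension w (single 0 r * f) = single 0 r * linear_extension w f"
proof -
  have "keys (single 0 r * f) \<subseteq> keys f" by (auto simp: in_keys_iff)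
  then have "linear_extension w (single 0 r * f) = (\<Sum>j\<in>keys f. single 0 (r * lookup f j) * w j)"
    by (simp add: linear_extension_superset[of "keys f"])
  also have "\<dots> = single 0 r * linear_extension w f"
    unfolding linear_extension_def sum_distrib_left
    by (simp flip: mult.assoc add: mult_single)
  finally show ?thesis .
qed

lemma linear_extension_single [simp]: "linear_extension w (single j 1) = w j"
  by (simp add: linear_extension_def)

lemma linear_extension_hom: "linear_extension w \<in> module_hom ring_of_type_algebra countable_free countable_free"
  by (simp add: module_hom_def linear_extension_add linear_extension_scale)

text \<open>
  A countable spanning set exhausts the space by an increasing sequence of finite-dimensional
  subspaces, each of which contains only finitely many members of an independent set.
\<close>

lemma (in vector_space) independent_countable:
  assumes "independent B" "countable C" "B \<subseteq> span C"
  shows "countable B"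
proof (cases "C = {}")
  case True
  then have "B \<subseteq> {0}" using assms(3) by simp
  then show ?thesis using countable_subset by blast
next
  case False
  define g where "g = from_nat_into C"
  have C: "C = range g" unfolding g_def using range_from_nat_into[OF False assms(2)] by simp
  have "B \<subseteq> (\<Union>N. B \<inter> span (g ` {..<N}))"
  proof
    fix x assume x: "x \<in> B"
    then have "x \<in> span C" using assms(3) by blast
    then obtain t r where t: "x = (\<Sum>a\<in>t. scale (r a) a)" "finite t" "t \<subseteq> C"
      unfolding span_explicit by blast
    obtain M where M: "finite M" "t = g ` M" using finite_subset_image[OF t(2), of g UNIV] t(3) C by blast
    obtain N where "M \<subseteq> {..<N}" using finite_nat_iff_bounded M(1) by blast
    then have "t \<subseteq> g ` {..<N}" using M(2) by blast
    then have "x \<in> span (g ` {..<N})" unfolding t(1) by (intro span_sum span_scale span_base) blast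
    then show "x \<in> (\<Union>N. B \<inter> span (g ` {..<N}))" using x by blast
  qed
  moreover have "countable (B \<inter> span (g ` {..<N}))" for N
  proof -
    have "independent (B \<inter> span (g ` {..<N}))" using assms(1) by (rule independent_mono) blast
    then have "finite (B \<inter> span (g ` {..<N}))"
      using independent_span_bound[of "g ` {..<N}" "B \<inter> span (g ` {..<N})"] by blast
    then show ?thesis by (rule countable_finite)
  qed
  ultimately show ?thesis by (meson countable_UN countable_subset uncountable_def UNIV_I countableI_type)
qed

definition submod :: "(nat \<Rightarrow>\<^sub>0 'a::comm_ring_1) set \<Rightarrow> bool" where
  "submod W \<longleftrightarrow> 0 \<in> W \<and> (\<forall>f\<in>W. \<forall>g\<in>W. f + g \<in> W) \<and> (\<forall>f\<in>W. \<forall>r. single 0 r * f \<in> W)"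

lemma submod_sum:
  assumes "submod W" "\<And>x. x \<in> A \<Longrightarrow> f x \<in> W"
  shows "sum f A \<in> W"
  using assms(2)
  by (induction A rule: infinite_finite_induct) (use assms(1) in \<open>auto simp: submod_def\<close>)

text \<open>
  The free module has the countable \<open>K\<close>-basis \<open>x\<^sup>a e\<^sub>j\<close>. Hence a submodule, being a \<open>K\<close>-subspace, has a
  countable \<open>K\<close>-basis, and in particular a sequence of generators.
\<close>

lemma submod_is_range:
  fixes W :: "(nat \<Rightarrow>\<^sub>0 ('n::finite, 'k::field) mpol) set"
  assumes "submod W"
  shows "\<exists>h\<in>module_hom mpol_ring countable_free countable_free. range h = W"
proof -
  define scl :: "'k \<Rightarrow> (nat \<Rightarrow>\<^sub>0 ('n, 'k) mpol) \<Rightarrow> (nat \<Rightarrow>\<^sub>0 ('n, 'k) mpol)" where "scl c f = single 0 (const c) * f" for c f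
  interpret V: vector_space scl
    by unfold_locales
      (auto intro!: poly_mapping_eqI simp: scl_def const_add const_mult lookup_add distrib_left distrib_right mult.assoc)
  obtain B where B: "B \<subseteq> W" "V.independent B" "W \<subseteq> V.span B"
    by (rule V.maximal_independent_subset)
  define C where "C = (\<lambda>(j :: nat, a). single j (monomial a :: ('n, 'k) mpol)) ` (UNIV \<times> UNIV)"
  have "countable (UNIV :: ('n \<Rightarrow>\<^sub>0 nat) set)"
  proof (rule countable_image_inj_on[of lookup])
    show "countable (range lookup :: ('n \<Rightarrow> nat) set)" by (rule countableI_type)
  qed (simp add: inj_def poly_mapping_eqI)
  then have "countable C" unfolding C_def by (intro countable_image countable_SIGMA) (auto intro: countableI_type)
  moreover have "B \<subseteq> V.span C"
  proof
    fix f
    have "single j p \<in> V.span C" for j and p :: "('n, 'k) mpol"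
    proof -
      have "single j p = (\<Sum>a\<in>keys p. scl (lookup p a) (single j (monomial a)))"
      proof -
        have "single j p = single j (\<Sum>a\<in>keys p. const (lookup p a) * monomial a)"
          by (simp flip: mpol_expansion)
        also have "\<dots> = (\<Sum>a\<in>keys p. single j (const (lookup p a) * monomial a))"
          by (rule poly_mapping_eqI) (simp add: lookup_sum lookup_single when_def)
        finally show ?thesis by (simp add: scl_def mult_single)
      qed
      also have "\<dots> \<in> V.span C"
        by (intro V.span_sum V.span_scale V.span_base) (auto simp: C_def)
      finally show ?thesis .
    qed
    then have "(\<Sum>j\<in>keys f. single j (lookup f j)) \<in> V.span C" by (intro V.span_sum)
    then show "f \<in> V.span C" using vector_expansion[of f] by (simp add: mult_single)
  qed
  ultimately have cB: "countable (insert 0 B)" using V.independent_countable B(2) by blast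
  \<comment> \<open>The zero vector makes the enumerated set nonempty.\<close>
  define w where "w = from_nat_into (insert 0 B)"
  have w: "range w = insert 0 B" unfolding w_def by (rule range_from_nat_into[OF _ cB]) simp
  have wW: "w j \<in> W" for j
    using w B(1) assms by (metis (no_types, lifting) insert_iff rangeI subsetD submod_def)
  have "range (linear_extension w) \<subseteq> W"
    using wW assms by (auto simp: linear_extension_def submod_def intro!: submod_sum[OF assms])
  moreover have "V.subspace (range (linear_extension w))"
  proof (rule V.subspaceI)
    show "0 \<in> range (linear_extension w)" by (rule range_eqI[of _ _ 0]) (simp add: linear_extension_def)
    show "x + y \<in> range (linear_extension w)" if "x \<in> range (linear_extension w)" "y \<in> range (linear_extension w)" for x y
      using that by (auto simp flip: linear_extension_add)
    show "scl c x \<in> range (linear_extension w)" if "x \<in> range (linear_extension w)" for c x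
      using that by (auto simp: scl_def simp flip: linear_extension_scale)
  qed
  moreover have "B \<subseteq> range (linear_extension w)"
  proof
    fix x assume "x \<in> B"
    then obtain j where "x = w j" using w by (metis image_iff insertI2)
    then have "x = linear_extension w (single j 1)" by simp
    then show "x \<in> range (linear_extension w)" by (rule range_eqI)
  qed
  ultimately have "range (linear_extension w) = W" using B(3) V.span_minimal by blast
  then show ?thesis using linear_extension_hom by blast
qed

lemma hom_countable_free_ker:
  assumes "h \<in> module_hom ring_of_type_algebra countable_free countable_free"
  shows "submod {f. h f = (0 :: nat \<Rightarrow>\<^sub>0 'a::comm_ring_1)}"
proof -
  have "h (0 + 0) = h 0 + h 0" using assms unfolding module_hom_def by (simp del: add_0_left add_0_right)
  then have "h 0 = 0" by simp
  then show ?thesis using assms by (simp add: module_hom_def submod_def)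
qed

text \<open>
  Every step of the resolution is the same countable free module, mapped onto the kernel of the
  previous map.
\<close>

lemma free_resolution_exists:
  fixes m :: "('n::finite, 'k::field) mpol set"
  assumes "ideal m mpol_ring"
  shows "\<exists>F d \<epsilon>. free_resolution mpol_ring (quot_by_ideal m) (F :: nat \<Rightarrow> (('n, 'k) mpol, nat \<Rightarrow>\<^sub>0 ('n, 'k) mpol) module) d \<epsilon>"
proof -
  define \<epsilon> where "\<epsilon> f = residue_class m (lookup f 0)" for f :: "nat \<Rightarrow>\<^sub>0 ('n, 'k) mpol"
  note [simp] = quot_by_ideal_simps[OF assms]
  have "submod {f. \<epsilon> f = m}"
    using assms by (auto simp: submod_def \<epsilon>_def residue_class_eq_self_iff lookup_add ideal_ring_of_type_algebra_iff)
  then have cover: "\<exists>h\<in>module_hom mpol_ring countable_free countable_free. range h = {f. \<epsilon> f = m}" by (rule submod_is_range)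
  have cover_ker: "\<exists>h'\<in>module_hom mpol_ring countable_free countable_free. range h' = {f. h f = 0}"
    if "h \<in> module_hom mpol_ring countable_free countable_free" for h :: "(nat \<Rightarrow>\<^sub>0 ('n, 'k) mpol) \<Rightarrow> _"
    by (rule submod_is_range[OF hom_countable_free_ker[OF that]])
  have "\<exists>d. \<forall>n. (d n \<in> module_hom mpol_ring countable_free countable_free \<and> (n = 0 \<longrightarrow> range (d n) = {f. \<epsilon> f = m}))
      \<and> range (d (Suc n)) = {f. d n f = 0}"
  proof (rule dependent_nat_choice)
    show "\<exists>h. h \<in> module_hom mpol_ring countable_free countable_free \<and> (0 = (0 :: nat) \<longrightarrow> range h = {f. \<epsilon> f = m})"
      using cover by blast
    show "\<exists>h'. (h' \<in> module_hom mpol_ring countable_free countable_free \<and> (Suc n = 0 \<longrightarrow> range h' = {f. \<epsilon> f = m}))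
        \<and> range h' = {f. h f = 0}"
      if "h \<in> module_hom mpol_ring countable_free countable_free \<and> (n = 0 \<longrightarrow> range h = {f. \<epsilon> f = m})"
      for h :: "(nat \<Rightarrow>\<^sub>0 ('n, 'k) mpol) \<Rightarrow> (nat \<Rightarrow>\<^sub>0 ('n, 'k) mpol)" and n
      using cover_ker[OF conjunct1[OF that]] by blast
  qed
  then obtain d where d: "\<forall>n. (d n \<in> module_hom mpol_ring countable_free countable_free \<and> (n = 0 \<longrightarrow> range (d n) = {f. \<epsilon> f = m}))
      \<and> range (d (Suc n)) = {f. d n f = 0}" by (rule exE)
  have "\<epsilon> \<in> module_hom mpol_ring countable_free (quot_by_ideal m)"
    by (auto simp: module_hom_def \<epsilon>_def lookup_add)
  moreover have "range \<epsilon> = range (residue_class m)"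
  proof (intro equalityI subsetI)
    fix C assume "C \<in> range (residue_class m)"
    then obtain p where "C = residue_class m p" by blast
    then have "C = \<epsilon> (single 0 p)" by (simp add: \<epsilon>_def)
    then show "C \<in> range \<epsilon>" by (rule range_eqI)
  qed (auto simp: \<epsilon>_def)
  ultimately have "free_resolution mpol_ring (quot_by_ideal m) (\<lambda>_. countable_free) d \<epsilon>"
    unfolding free_resolution_def using d free_module_countable_free by (intro conjI allI) simp_all
  then show ?thesis by blast
qed

section \<open>Dimension from coordinates\<close>

text \<open>
  A bijection onto the functions supported on \<open>T\<close> that respects the operations transports the vector
  space axioms to \<open>V\<close>, and the unit functions correspond to a basis.
\<close>

lemma dim_from_coordinates:
  fixes V :: "('k::field, 'v) module" and \<Phi> :: "'v \<Rightarrow> 't \<Rightarrow> 'k"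
  assumes fin: "finite T"
    and inj: "inj_on \<Phi> (carrier V)"
    and im: "\<Phi> ` carrier V = {g. \<forall>t. t \<notin> T \<longrightarrow> g t = 0}"
    and zero: "\<zero>\<^bsub>V\<^esub> \<in> carrier V" "\<Phi> \<zero>\<^bsub>V\<^esub> = (\<lambda>t. 0)"
    and add: "\<And>x y. x \<in> carrier V \<Longrightarrow> y \<in> carrier V \<Longrightarrow> x \<oplus>\<^bsub>V\<^esub> y \<in> carrier V"
      "\<And>x y. x \<in> carrier V \<Longrightarrow> y \<in> carrier V \<Longrightarrow> \<Phi> (x \<oplus>\<^bsub>V\<^esub> y) = (\<lambda>t. \<Phi> x t + \<Phi> y t)"
    and scale: "\<And>c x. x \<in> carrier V \<Longrightarrow> c \<odot>\<^bsub>V\<^esub> x \<in> carrier V"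
      "\<And>c x. x \<in> carrier V \<Longrightarrow> \<Phi> (c \<odot>\<^bsub>V\<^esub> x) = (\<lambda>t. c * \<Phi> x t)"
  shows "vectorspace.dim ring_of_type_algebra V = card T"
proof -
  note eqI = inj_onD[OF inj]
  have field: "field (ring_of_type_algebra :: 'k ring)" by (rule field_from_type_algebra)
  have group: "abelian_group V"
  proof (rule abelian_groupI)
    fix x assume x: "x \<in> carrier V"
    have "(- 1) \<odot>\<^bsub>V\<^esub> x \<oplus>\<^bsub>V\<^esub> x = \<zero>\<^bsub>V\<^esub>"
      using x by (intro eqI) (simp_all add: add scale zero)
    then show "\<exists>y\<in>carrier V. y \<oplus>\<^bsub>V\<^esub> x = \<zero>\<^bsub>V\<^esub>" using x scale(1) by blast
  qed (auto intro!: eqI simp: add zero add_ac)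
  have "module ring_of_type_algebra V"
    by (rule moduleI[OF cring_from_type_algebra group])
      (auto intro!: eqI simp: add scale algebra_simps)
  then interpret V: vectorspace ring_of_type_algebra V
    using field by (rule vectorspace.intro)
  have finsum: "finsum V g A \<in> carrier V \<and> \<Phi> (finsum V g A) s = (\<Sum>v\<in>A. \<Phi> (g v) s)"
    if "finite A" "g ` A \<subseteq> carrier V" for g A s
    using that
  proof (induction A rule: finite_induct)
    case (insert v A)
    then show ?case by (subst V.finsum_insert; (subst V.finsum_insert)?) (auto simp: add)
  qed (simp add: zero)
  define b where "b t = inv_into (carrier V) \<Phi> (\<lambda>s. if s = t then 1 else 0)" for t
  have b: "b t \<in> carrier V \<and> \<Phi> (b t) = (\<lambda>s. if s = t then 1 else 0)" if "t \<in> T" for t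
  proof -
    have "(\<lambda>s. if s = t then 1 else 0) \<in> \<Phi> ` carrier V" using that unfolding im by auto
    then show ?thesis unfolding b_def by (simp add: inv_into_into f_inv_into_f)
  qed
  have inj_b: "inj_on b T"
  proof (rule inj_onI)
    fix s t assume st: "s \<in> T" "t \<in> T" "b s = b t"
    then have "\<Phi> (b s) s = \<Phi> (b t) s" by simp
    then show "s = t" using b[OF st(1)] b[OF st(2)] by (simp split: if_splits)
  qed
  have lincomb: "\<Phi> (V.lincomb a A) s = (\<Sum>v\<in>A. a v * \<Phi> v s)"
    if "finite A" "A \<subseteq> carrier V" for a A s
  proof -
    have "\<Phi> (V.lincomb a A) s = (\<Sum>v\<in>A. \<Phi> (a v \<odot>\<^bsub>V\<^esub> v) s)"
      unfolding V.lincomb_def using finsum[OF that(1), of "\<lambda>v. a v \<odot>\<^bsub>V\<^esub> v"] that(2) scale(1) by blast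
    also have "\<dots> = (\<Sum>v\<in>A. a v * \<Phi> v s)"
      using that(2) by (intro sum.cong refl) (auto simp: scale(2))
    finally show ?thesis .
  qed
  have bT: "b ` T \<subseteq> carrier V" using b by blast
  have "V.basis (b ` T)"
    unfolding V.basis_def
  proof (intro conjI bT)
    show "\<not> V.lin_dep (b ` T)"
    proof
      assume "V.lin_dep (b ` T)"
      then obtain A a v where A: "finite A" "A \<subseteq> b ` T" "V.lincomb a A = \<zero>\<^bsub>V\<^esub>" "v \<in> A" "a v \<noteq> 0"
        unfolding V.lin_dep_def by auto
      then obtain t where t: "t \<in> T" "v = b t" by blast
      have "(\<Sum>w\<in>A. a w * \<Phi> w t) = (\<Sum>w\<in>A. if w = v then a v else 0)"
      proof (intro sum.cong refl)
        fix w assume "w \<in> A"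
        then obtain s where s: "s \<in> T" "w = b s" using A(2) by blast
        then have "w = v \<longleftrightarrow> s = t" using t inj_b by (auto dest: inj_onD)
        then show "a w * \<Phi> w t = (if w = v then a v else 0)" using b[OF s(1)] s(2) by auto
      qed
      also have "\<dots> = a v" using A(1,4) by simp
      finally have "\<Phi> (V.lincomb a A) t = a v" using lincomb[OF A(1)] A(2) bT by auto
      then show False using A(3,5) zero(2) by simp
    qed
    show "V.span (b ` T) = carrier V"
    proof
      show "V.span (b ` T) \<subseteq> carrier V" using bT by (rule V.span_is_subset2)
      show "carrier V \<subseteq> V.span (b ` T)"
      proof
        fix x assume x: "x \<in> carrier V"
        define a where "a v = \<Phi> x (inv_into T b v)" for v
        have "V.lincomb a (b ` T) = x"
        proof (rule eqI)
          show "V.lincomb a (b ` T) \<in> carrier V"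
            unfolding V.lincomb_def
            using finsum[OF finite_imageI[OF fin], of "\<lambda>v. a v \<odot>\<^bsub>V\<^esub> v"] bT scale(1) by blast
          have "\<Phi> (V.lincomb a (b ` T)) s = \<Phi> x s" for s
          proof -
            have "\<Phi> (V.lincomb a (b ` T)) s = (\<Sum>t\<in>T. a (b t) * \<Phi> (b t) s)"
              using lincomb[OF finite_imageI[OF fin] bT] by (simp add: sum.reindex[OF inj_b])
            also have "\<dots> = (\<Sum>t\<in>T. if s = t then \<Phi> x t else 0)"
              using b inj_b by (intro sum.cong refl) (auto simp: a_def)
            also have "\<dots> = (if s \<in> T then \<Phi> x s else 0)" using fin by (simp add: sum.delta')
            also have "\<dots> = \<Phi> x s" using im x by auto
            finally show ?thesis .
          qed
          then show "\<Phi> (V.lincomb a (b ` T)) = \<Phi> x" by (rule ext)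
        qed (rule x)
        then show "x \<in> V.span (b ` T)"
          unfolding V.span_def using fin by fastforce
      qed
    qed
  qed
  then have "V.dim = card (b ` T)" using V.dim_basis[of "b ` T"] fin by blast
  then show ?thesis by (simp add: card_image[OF inj_b])
qed

section \<open>Socle monomials\<close>

lemma lookup_monomial_mult: "lookup (monomial b * p) (b + a) = lookup p a"
proof -
  have "lookup (monomial b * p) (b + a) = lookup (monomial b) b * lookup p a"
    by (rule lookup_mult_unique) (simp add: monomial_def split: if_splits)
  then show ?thesis by (simp add: monomial_def)
qed

text \<open>
  Multiplication by a variable shifts the support, so an element multiplied into \<open>L\<close> by all variables
  has each of its exponents in \<open>E\<close> or in the socle.
\<close>

lemma monomial_span_colon:
  fixes p :: "('n::finite, 'k::field) mpol"
  assumes "\<And>i. var i * p \<in> monomial_span E"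
  shows "p \<in> monomial_span (E \<union> socle E)"
proof -
  have "a + single i 1 \<in> E" if "a \<in> keys p" for a i
  proof -
    have "lookup (var i * p) (single i 1 + a) \<noteq> 0"
      using that unfolding var_def lookup_monomial_mult by (simp add: in_keys_iff)
    then have "single i 1 + a \<in> E" using assms[of i] by (auto simp: monomial_span_def in_keys_iff)
    then show ?thesis by (simp add: add.commute)
  qed
  then show ?thesis by (auto simp: monomial_span_def socle_def)
qed

lemma maximal_ideal_mult_socle:
  assumes "upset E"
    and "r \<in> monomial_span {a. a \<noteq> 0}" "p \<in> monomial_span (socle E)"
  shows "r * p \<in> monomial_span E"
proof -
  have "sumset {a. a \<noteq> 0} (socle E) \<subseteq> E"
  proof
    fix x assume "x \<in> sumset {a. a \<noteq> 0} (socle E)"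
    then obtain a s where x: "x = a + s" "a \<noteq> 0" "s \<in> socle E" by (auto simp: sumset_def)
    have "\<not> (\<forall>i. lookup a i = 0)" using x(2) by (auto simp: poly_mapping_eq_iff fun_eq_iff)
    then obtain i where i: "lookup a i \<noteq> 0" by blast
    have "s + single i 1 \<in> E" using x(3) by (simp add: socle_def)
    then show "x \<in> E"
      by (rule upset_mono[OF assms(1)]) (use i in \<open>auto simp: x lookup_add lookup_single when_def\<close>)
  qed
  then show ?thesis using monomial_span_mult[OF assms(2,3)] monomial_span_mono by blast
qed

text \<open>
  The coefficients on \<open>T\<close> of a residue class, read off from an arbitrary representative; they are
  well defined if no exponent in \<open>T\<close> occurs in the ideal.
\<close>

definition coords :: "('n \<Rightarrow>\<^sub>0 nat) set \<Rightarrow> ('n::finite, 'k::field) mpol set \<Rightarrow> ('n \<Rightarrow>\<^sub>0 nat) \<Rightarrow> 'k" where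
  "coords T C = (\<lambda>a. if a \<in> T then lookup (SOME p. p \<in> C) a else 0)"

lemma coords_residue_class:
  assumes "T \<inter> E = {}"
  shows "coords T (residue_class (monomial_span E) p) = (\<lambda>a. if a \<in> T then lookup p a else 0)"
proof -
  have "p \<in> residue_class (monomial_span E) p" unfolding residue_class_def by (rule image_eqI[of _ _ 0]) (simp_all add: monomial_span_def)
  then have "(SOME q. q \<in> residue_class (monomial_span E) p) \<in> residue_class (monomial_span E) p" by (rule someI)
  then obtain l where l: "l \<in> monomial_span E" "(SOME q. q \<in> residue_class (monomial_span E) p) = l + p" by (auto simp: residue_class_def)
  have "lookup l a = 0" if "a \<in> T" for a
    using l(1) that assms by (auto simp: monomial_span_def in_keys_iff)
  then show ?thesis by (auto simp: coords_def l(2) lookup_add)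
qed

section \<open>Ext in degree zero\<close>

text \<open>
  In degree \<open>0\<close> the coboundaries are zero, so a cohomology class is the singleton of a homomorphism
  that vanishes on the image of \<open>d 0\<close>.
\<close>

lemma hom_cohomology_0_simps:
  fixes R :: "('a, 'm) ring_scheme" and F :: "nat \<Rightarrow> ('a, 'f) module" and d :: "nat \<Rightarrow> 'f \<Rightarrow> 'f"
    and M :: "('a, 'b, 'c) module_scheme" and \<phi> :: "'k \<Rightarrow> 'a"
  defines "Z \<equiv> {f \<in> module_hom R (F 0) M \<inter> extensional (carrier (F 0)).
      \<forall>x\<in>carrier (F 1). f (d 0 x) = \<zero>\<^bsub>M\<^esub>}"
    and "V \<equiv> restrict_scalars \<phi> (hom_cohomology R F d M 0)"
  assumes zero: "\<forall>x\<in>carrier M. \<zero>\<^bsub>M\<^esub> \<oplus>\<^bsub>M\<^esub> x = x"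
    and closed: "\<forall>c. \<forall>x\<in>carrier M. \<phi> c \<odot>\<^bsub>M\<^esub> x \<in> carrier M"
  shows "carrier V = (\<lambda>f. {f}) ` Z"
    and "\<zero>\<^bsub>V\<^esub> = {\<lambda>x\<in>carrier (F 0). \<zero>\<^bsub>M\<^esub>}"
    and "\<And>f g. f \<in> Z \<Longrightarrow> g \<in> Z \<Longrightarrow> {f} \<oplus>\<^bsub>V\<^esub> {g} = {\<lambda>x\<in>carrier (F 0). f x \<oplus>\<^bsub>M\<^esub> g x}"
    and "\<And>c f. f \<in> Z \<Longrightarrow> c \<odot>\<^bsub>V\<^esub> {f} = {\<lambda>x\<in>carrier (F 0). \<phi> c \<odot>\<^bsub>M\<^esub> f x}"
proof -
  define H where "H = hom_module R (F 0) M"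
  define z where "z = (\<lambda>x\<in>carrier (F 0). \<zero>\<^bsub>M\<^esub>)"
  have Z: "Z = {f \<in> carrier H. (\<lambda>x\<in>carrier (F (Suc 0)). f (d 0 x)) = \<zero>\<^bsub>hom_module R (F (Suc 0)) M\<^esub>}"
    by (auto simp: Z_def H_def hom_module_def restrict_def fun_eq_iff)
  have V: "V = restrict_scalars \<phi> (quot_module (H\<lparr>carrier := Z\<rparr>) {z})"
    unfolding V_def hom_cohomology_def Let_def Z H_def[symmetric]
    by (simp add: H_def hom_module_def z_def)
  have carr: "f x \<in> carrier M" if "f \<in> Z" "x \<in> carrier (F 0)" for f x
    using that by (auto simp: Z_def module_hom_def)
  have ext: "f \<in> extensional (carrier (F 0))" if "f \<in> Z" for f using that by (simp add: Z_def)
  have addH: "f \<oplus>\<^bsub>H\<^esub> g = (\<lambda>x\<in>carrier (F 0). f x \<oplus>\<^bsub>M\<^esub> g x)" for f g by (simp add: H_def hom_module_def)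
  have scaleH: "r \<odot>\<^bsub>H\<^esub> f = (\<lambda>x\<in>carrier (F 0). r \<odot>\<^bsub>M\<^esub> f x)" for r f by (simp add: H_def hom_module_def)
  have z_add: "z \<oplus>\<^bsub>H\<^esub> f = f" if "\<And>x. x \<in> carrier (F 0) \<Longrightarrow> f x \<in> carrier M" "f \<in> extensional (carrier (F 0))" for f
    unfolding addH by (rule extensionalityI[of _ "carrier (F 0)"]) (use that zero in \<open>auto simp: z_def\<close>)
  have rcos: "{z} +>\<^bsub>H\<lparr>carrier := Z\<rparr>\<^esub> f = {z \<oplus>\<^bsub>H\<^esub> f}" for f
    by (auto simp: a_r_coset_def r_coset_def)
  have "carrier V = (\<lambda>f. {z \<oplus>\<^bsub>H\<^esub> f}) ` Z"
    by (auto simp: V restrict_scalars_def quot_module_def A_RCOSETS_def RCOSETS_def r_coset_def)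
  also have "\<dots> = (\<lambda>f. {f}) ` Z"
    by (intro image_cong refl) (simp add: z_add carr ext)
  finally show "carrier V = (\<lambda>f. {f}) ` Z" .
  show "\<zero>\<^bsub>V\<^esub> = {\<lambda>x\<in>carrier (F 0). \<zero>\<^bsub>M\<^esub>}"
    by (simp add: V restrict_scalars_def quot_module_def z_def)
  show "{f} \<oplus>\<^bsub>V\<^esub> {g} = {\<lambda>x\<in>carrier (F 0). f x \<oplus>\<^bsub>M\<^esub> g x}" if "f \<in> Z" "g \<in> Z" for f g
    by (simp add: V restrict_scalars_def quot_module_def set_add_def set_mult_def addH)
  show "c \<odot>\<^bsub>V\<^esub> {f} = {\<lambda>x\<in>carrier (F 0). \<phi> c \<odot>\<^bsub>M\<^esub> f x}" if "f \<in> Z" for c f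
  proof -
    have "c \<odot>\<^bsub>V\<^esub> {f} = {z \<oplus>\<^bsub>H\<^esub> (\<phi> c \<odot>\<^bsub>H\<^esub> f)}"
      by (simp add: V restrict_scalars_def quot_module_def rcos)
    also have "\<dots> = {\<phi> c \<odot>\<^bsub>H\<^esub> f}"
      using carr[OF that] closed by (subst z_add) (auto simp: scaleH)
    finally show ?thesis by (simp add: scaleH)
  qed
qed

text \<open>
  For \<open>K = S/(x\<^sub>1, \<dots>, x\<^sub>n)\<close> and any free resolution of it, let \<open>u\<close> be a preimage of \<open>1\<close> under the
  augmentation \<open>\<epsilon>\<close>. A homomorphism \<open>f\<close> that vanishes on the kernel of \<open>\<epsilon>\<close> is determined by \<open>f u\<close>, and
  \<open>f u\<close> can be any element of \<open>S/L\<close> that is killed by all variables. So the coefficients of \<open>f u\<close> at the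
  socle exponents are coordinates.
\<close>

lemma dim_Ext_0:
  fixes E :: "('n::finite \<Rightarrow>\<^sub>0 nat) set" and F :: "nat \<Rightarrow> (('n, 'k::field) mpol, 'f) module"
  defines "L \<equiv> monomial_span E :: ('n, 'k) mpol set" and "m \<equiv> monomial_span {a. a \<noteq> 0} :: ('n, 'k) mpol set"
  assumes "upset E" "finite (socle E)"
    and res: "free_resolution mpol_ring (quot_by_ideal m) F d \<epsilon>"
  shows "vectorspace.dim (ring_of_type_algebra :: 'k ring)
    (restrict_scalars const (hom_cohomology mpol_ring F d (quot_by_ideal L) 0)) = card (socle E)"
proof -
  define T where "T = socle E"
  define M where "M = quot_by_ideal L"
  define F0 where "F0 = carrier (F 0)"
  have L: "ideal L mpol_ring" unfolding L_def by (rule monomial_span_ideal[OF assms(3)])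
  have m: "ideal m mpol_ring" unfolding m_def
    by (rule monomial_span_ideal) (auto simp: upset_def poly_mapping_eq_iff fun_eq_iff lookup_add)
  note Ms = quot_by_ideal_simps[OF L, folded M_def]
  note Ns = quot_by_ideal_simps[OF m]
  note L_iff = residue_class_eq_iff[OF L] residue_class_eq_self_iff[OF L]
  note m_iff = residue_class_eq_iff[OF m] residue_class_eq_self_iff[OF m]
  have TE: "T \<inter> E = {}" by (auto simp: T_def socle_def)
  have coords: "coords T (residue_class L p) = (\<lambda>a. if a \<in> T then lookup p a else 0)" for p
    unfolding L_def by (rule coords_residue_class[OF TE])
  interpret F0: module mpol_ring "F 0" using res by (simp add: free_resolution_def free_module_def)
  have eps: "\<epsilon> \<in> module_hom mpol_ring (F 0) (quot_by_ideal m)" "\<epsilon> ` F0 = range (residue_class m)"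
    "{x \<in> F0. \<epsilon> x = m} = d 0 ` carrier (F 1)"
    using res by (simp_all add: free_resolution_def F0_def Ns)
  have eps_add: "\<epsilon> (x \<oplus>\<^bsub>F 0\<^esub> y) = \<epsilon> x \<oplus>\<^bsub>quot_by_ideal m\<^esub> \<epsilon> y" if "x \<in> F0" "y \<in> F0" for x y
    using eps(1) that by (simp add: module_hom_def F0_def)
  have eps_scale: "\<epsilon> (r \<odot>\<^bsub>F 0\<^esub> x) = r \<odot>\<^bsub>quot_by_ideal m\<^esub> \<epsilon> x" if "x \<in> F0" for r x
    using eps(1) that by (simp add: module_hom_def F0_def)
  have F0_closed: "x \<oplus>\<^bsub>F 0\<^esub> y \<in> F0" "r \<odot>\<^bsub>F 0\<^esub> x \<in> F0" if "x \<in> F0" "y \<in> F0" for x y r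
    using that by (simp_all add: F0_def)
  have M_zero: "\<forall>x\<in>carrier M. \<zero>\<^bsub>M\<^esub> \<oplus>\<^bsub>M\<^esub> x = x"
    using Ms(3)[of 0] by (auto simp: Ms)
  have M_scale: "\<forall>c. \<forall>x\<in>carrier M. const c \<odot>\<^bsub>M\<^esub> x \<in> carrier M"
    by (auto simp: Ms)
  define Z where "Z = {f \<in> module_hom mpol_ring (F 0) M \<inter> extensional F0.
      \<forall>x\<in>carrier (F 1). f (d 0 x) = \<zero>\<^bsub>M\<^esub>}"
  define V where "V = restrict_scalars const (hom_cohomology mpol_ring F d M 0)"
  note Vs = hom_cohomology_0_simps[where M = M and \<phi> = const and R = mpol_ring and F = F and d = d,
      OF M_zero M_scale, folded F0_def, folded Z_def V_def]
  have Z_iff: "f \<in> Z \<longleftrightarrow> (\<forall>x\<in>F0. f x \<in> range (residue_class L)) \<and>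
      (\<forall>x\<in>F0. \<forall>y\<in>F0. f (x \<oplus>\<^bsub>F 0\<^esub> y) = f x \<oplus>\<^bsub>M\<^esub> f y) \<and>
      (\<forall>r. \<forall>x\<in>F0. f (r \<odot>\<^bsub>F 0\<^esub> x) = r \<odot>\<^bsub>M\<^esub> f x) \<and>
      f \<in> extensional F0 \<and> (\<forall>x\<in>F0. \<epsilon> x = m \<longrightarrow> f x = L)" for f
  proof -
    have "(\<forall>x\<in>carrier (F 1). f (d 0 x) = L) \<longleftrightarrow> (\<forall>y \<in> d 0 ` carrier (F 1). f y = L)" by blast
    also have "\<dots> \<longleftrightarrow> (\<forall>x\<in>F0. \<epsilon> x = m \<longrightarrow> f x = L)" unfolding eps(3)[symmetric] by blast
    finally have ker: "(\<forall>x\<in>carrier (F 1). f (d 0 x) = L) \<longleftrightarrow> (\<forall>x\<in>F0. \<epsilon> x = m \<longrightarrow> f x = L)" .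
    have hom: "f \<in> module_hom mpol_ring (F 0) M \<longleftrightarrow> (\<forall>x\<in>F0. f x \<in> range (residue_class L)) \<and>
      (\<forall>x\<in>F0. \<forall>y\<in>F0. f (x \<oplus>\<^bsub>F 0\<^esub> y) = f x \<oplus>\<^bsub>M\<^esub> f y) \<and>
      (\<forall>r. \<forall>x\<in>F0. f (r \<odot>\<^bsub>F 0\<^esub> x) = r \<odot>\<^bsub>M\<^esub> f x)"
      unfolding module_hom_def F0_def[symmetric] Ms(1) Pi_iff ring_of_type_algebra_simps mem_Collect_eq
      by blast
    show ?thesis unfolding Z_def mem_Collect_eq Int_iff Ms(2) ker hom by blast
  qed
  have residue_classE: "\<exists>p. C = residue_class L p" if "C \<in> range (residue_class L)" for C using that by blast
  obtain u where u: "u \<in> F0" "\<epsilon> u = residue_class m 1" using eps(2) by (metis image_iff rangeI)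
  have at_x: "\<exists>q. f x = q \<odot>\<^bsub>M\<^esub> f u \<and> \<epsilon> x = residue_class m q" if "f \<in> Z" "x \<in> F0" for f x
  proof -
    obtain q where q: "\<epsilon> x = residue_class m q" using eps(2) \<open>x \<in> F0\<close> by blast
    \<comment> \<open>The part of \<open>x\<close> that \<open>\<epsilon>\<close> kills.\<close>
    define y where "y = x \<ominus>\<^bsub>F 0\<^esub> q \<odot>\<^bsub>F 0\<^esub> u"
    have y: "y \<in> F0" "x = y \<oplus>\<^bsub>F 0\<^esub> q \<odot>\<^bsub>F 0\<^esub> u"
      using \<open>x \<in> F0\<close> u(1) by (simp_all add: y_def F0_def a_minus_def F0.M.a_assoc F0.M.l_neg)
    obtain r where r: "\<epsilon> y = residue_class m r" using eps(2) y(1) by blast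
    have "\<epsilon> x = residue_class m (r + q)"
      using y u F0_closed r by (simp add: eps_add eps_scale Ns)
    then have "residue_class m (r + q) = residue_class m q" using q by simp
    then have "r \<in> m" by (simp add: m_iff)
    then have "\<epsilon> y = m" using r by (simp add: m_iff)
    then have "f y = L" using \<open>f \<in> Z\<close> y(1) by (simp add: Z_iff)
    then have "f x = L \<oplus>\<^bsub>M\<^esub> (q \<odot>\<^bsub>M\<^esub> f u)"
      using y u(1) \<open>f \<in> Z\<close> F0_closed[OF u(1) u(1)] unfolding Z_iff by metis
    moreover obtain p where "f u = residue_class L p" using \<open>f \<in> Z\<close> u(1) residue_classE by (auto simp: Z_iff)
    moreover have "L \<oplus>\<^bsub>M\<^esub> residue_class L (q * p) = residue_class L (q * p)" using Ms(3)[of 0 "q * p"] by simp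
    ultimately have "f x = q \<odot>\<^bsub>M\<^esub> f u" by (simp add: Ms)
    then show ?thesis using q by blast
  qed
  have at_u: "\<exists>p. f u = residue_class L p \<and> p \<in> monomial_span (E \<union> T)" if fZ: "f \<in> Z" for f
  proof -
    obtain p where p: "f u = residue_class L p" using fZ u(1) residue_classE by (auto simp: Z_iff)
    have "var i * p \<in> L" for i
    proof -
      have "single i (1 :: nat) \<noteq> 0"
        by (simp add: poly_mapping_eq_iff fun_eq_iff lookup_single when_def)
      then have "var i \<in> m" by (simp add: m_def var_def)
      then have "\<epsilon> (var i \<odot>\<^bsub>F 0\<^esub> u) = m" using u by (simp add: eps_scale Ns m_iff)
      then have "f (var i \<odot>\<^bsub>F 0\<^esub> u) = L" using fZ u(1) F0_closed by (simp add: Z_iff)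
      moreover have "f (var i \<odot>\<^bsub>F 0\<^esub> u) = residue_class L (var i * p)" using fZ u(1) p by (simp add: Z_iff Ms)
      ultimately show ?thesis by (simp add: L_iff)
    qed
    then show ?thesis using p monomial_span_colon unfolding T_def L_def by blast
  qed
  define \<Phi> where "\<Phi> S = coords T (the_elem S u)" for S :: "('f \<Rightarrow> ('n, 'k) mpol set) set"
  have zero_in: "(\<lambda>x\<in>F0. L) \<in> Z"
    unfolding Z_iff using F0_closed Ms(3)[of 0 0] Ms(4)[of _ 0] by (auto intro: range_eqI[of _ _ 0])
  have add_in: "(\<lambda>x\<in>F0. f x \<oplus>\<^bsub>M\<^esub> g x) \<in> Z" if fg: "f \<in> Z" "g \<in> Z" for f g
  proof -
    have rep: "\<exists>p q. f x = residue_class L p \<and> g x = residue_class L q" if "x \<in> F0" for x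
      using fg that residue_classE by (auto simp: Z_iff)
    show ?thesis
      unfolding Z_iff
    proof (intro conjI ballI allI impI)
      fix x assume x: "x \<in> F0"
      obtain p q where pq: "f x = residue_class L p" "g x = residue_class L q" using rep[OF x] by blast
      show "(\<lambda>x\<in>F0. f x \<oplus>\<^bsub>M\<^esub> g x) x \<in> range (residue_class L)" using x pq by (simp add: Ms)
      show "(\<lambda>x\<in>F0. f x \<oplus>\<^bsub>M\<^esub> g x) x = L" if "\<epsilon> x = m"
        using fg x that Ms(3)[of 0 0] by (simp add: Z_iff)
      show "(\<lambda>x\<in>F0. f x \<oplus>\<^bsub>M\<^esub> g x) (r \<odot>\<^bsub>F 0\<^esub> x) = r \<odot>\<^bsub>M\<^esub> (\<lambda>x\<in>F0. f x \<oplus>\<^bsub>M\<^esub> g x) x" for r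
        using fg x F0_closed pq by (simp add: Z_iff Ms distrib_left)
      fix y assume y: "y \<in> F0"
      obtain p' q' where pq': "f y = residue_class L p'" "g y = residue_class L q'" using rep[OF y] by blast
      show "(\<lambda>x\<in>F0. f x \<oplus>\<^bsub>M\<^esub> g x) (x \<oplus>\<^bsub>F 0\<^esub> y) =
          (\<lambda>x\<in>F0. f x \<oplus>\<^bsub>M\<^esub> g x) x \<oplus>\<^bsub>M\<^esub> (\<lambda>x\<in>F0. f x \<oplus>\<^bsub>M\<^esub> g x) y"
        using fg x y F0_closed pq pq' by (simp add: Z_iff Ms add_ac)
    qed simp
  qed
  have scale_in: "(\<lambda>x\<in>F0. const c \<odot>\<^bsub>M\<^esub> f x) \<in> Z" if f: "f \<in> Z" for f c
  proof -
    have rep: "\<exists>p. f x = residue_class L p" if "x \<in> F0" for x using f that residue_classE by (auto simp: Z_iff)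
    show ?thesis
      unfolding Z_iff
    proof (intro conjI ballI allI impI)
      fix x assume x: "x \<in> F0"
      obtain p where p: "f x = residue_class L p" using rep[OF x] by blast
      show "(\<lambda>x\<in>F0. const c \<odot>\<^bsub>M\<^esub> f x) x \<in> range (residue_class L)" using x p by (simp add: Ms)
      show "(\<lambda>x\<in>F0. const c \<odot>\<^bsub>M\<^esub> f x) x = L" if "\<epsilon> x = m"
        using f x that Ms(4)[of _ 0] by (simp add: Z_iff)
      show "(\<lambda>x\<in>F0. const c \<odot>\<^bsub>M\<^esub> f x) (r \<odot>\<^bsub>F 0\<^esub> x) = r \<odot>\<^bsub>M\<^esub> (\<lambda>x\<in>F0. const c \<odot>\<^bsub>M\<^esub> f x) x" for r
        using f x F0_closed p by (simp add: Z_iff Ms mult.left_commute)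
      fix y assume y: "y \<in> F0"
      obtain p' where p': "f y = residue_class L p'" using rep[OF y] by blast
      show "(\<lambda>x\<in>F0. const c \<odot>\<^bsub>M\<^esub> f x) (x \<oplus>\<^bsub>F 0\<^esub> y) =
          (\<lambda>x\<in>F0. const c \<odot>\<^bsub>M\<^esub> f x) x \<oplus>\<^bsub>M\<^esub> (\<lambda>x\<in>F0. const c \<odot>\<^bsub>M\<^esub> f x) y"
        using f x y F0_closed p p' by (simp add: Z_iff Ms distrib_left)
    qed simp
  qed
  have inj: "f = g" if fg: "f \<in> Z" "g \<in> Z" and eq: "coords T (f u) = coords T (g u)" for f g
  proof -
    obtain p where p: "f u = residue_class L p" "p \<in> monomial_span (E \<union> T)" using at_u[OF fg(1)] by blast
    obtain q where q: "g u = residue_class L q" "q \<in> monomial_span (E \<union> T)" using at_u[OF fg(2)] by blast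
    have on_T: "lookup p a = lookup q a" if "a \<in> T" for a
      using fun_cong[OF eq, of a] that p(1) q(1) by (simp add: coords)
    have "a \<in> E" if "lookup p a \<noteq> lookup q a" for a
    proof -
      have "lookup p a \<noteq> 0 \<or> lookup q a \<noteq> 0" using that by auto
      then have "a \<in> E \<union> T" using p(2) q(2) by (auto simp: monomial_span_def in_keys_iff)
      then show ?thesis using that on_T by blast
    qed
    then have "p - q \<in> L"
      by (auto simp: L_def monomial_span_def in_keys_iff lookup_minus)
    then have fu: "f u = g u" using p(1) q(1) by (simp add: L_iff)
    show "f = g"
    proof (rule extensionalityI[of _ F0])
      show "f \<in> extensional F0" "g \<in> extensional F0" using fg by (auto simp: Z_iff)
      fix x assume x: "x \<in> F0"
      obtain q where q: "f x = q \<odot>\<^bsub>M\<^esub> f u" "\<epsilon> x = residue_class m q" using at_x[OF fg(1) x] by blast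
      obtain q' where q': "g x = q' \<odot>\<^bsub>M\<^esub> g u" "\<epsilon> x = residue_class m q'" using at_x[OF fg(2) x] by blast
      have "residue_class m q = residue_class m q'" using q(2) q'(2) by simp
      then have "q - q' \<in> m" by (simp add: m_iff)
      then have "\<epsilon> ((q - q') \<odot>\<^bsub>F 0\<^esub> u) = m" using u by (simp add: eps_scale Ns m_iff)
      then have "g ((q - q') \<odot>\<^bsub>F 0\<^esub> u) = L" using fg(2) u(1) F0_closed by (simp add: Z_iff)
      then have "(q - q') \<odot>\<^bsub>M\<^esub> g u = L" using fg(2) u(1) by (simp add: Z_iff)
      moreover obtain p where p: "g u = residue_class L p" using at_u[OF fg(2)] by blast
      ultimately have "(q - q') * p \<in> L" by (simp add: Ms L_iff)
      then show "f x = g x" using q(1) q'(1) fu p by (simp add: Ms L_iff left_diff_distrib)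
    qed
  qed
  have surj: "\<exists>f\<in>Z. coords T (f u) = g" if g: "\<And>t. t \<notin> T \<Longrightarrow> g t = 0" for g
  proof -
    define p where "p = (\<Sum>a\<in>T. const (g a) * monomial a :: ('n, 'k) mpol)"
    have lookup_p: "lookup p a = g a" for a
      using g assms(4) by (auto simp: p_def lookup_sum monomial_def lookup_single when_def T_def if_distrib cong: if_cong)
    have "a \<in> T" if "g a \<noteq> 0" for a using g[of a] that by blast
    then have p: "p \<in> monomial_span T" by (auto simp: monomial_span_def in_keys_iff lookup_p)
    have mp: "r * p \<in> L" if "r \<in> m" for r
      using maximal_ideal_mult_socle[OF assms(3)] that p unfolding m_def L_def T_def by blast
    define q where "q x = (SOME q. \<epsilon> x = residue_class m q)" for x
    have q: "\<epsilon> x = residue_class m (q x)" if "x \<in> F0" for x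
      unfolding q_def using eps(2) that by (intro someI_ex[of "\<lambda>q. \<epsilon> x = residue_class m q"]) blast
    have cong: "residue_class L (r * p) = residue_class L (s * p)" if "residue_class m r = residue_class m s" for r s
      using mp[of "r - s"] that by (simp add: m_iff L_iff left_diff_distrib)
    define f where "f = (\<lambda>x\<in>F0. residue_class L (q x * p))"
    have "f \<in> Z"
      unfolding Z_iff
    proof (intro conjI ballI allI impI)
      fix x assume x: "x \<in> F0"
      show "f x \<in> range (residue_class L)" using x by (simp add: f_def)
      show "f x = L" if "\<epsilon> x = m"
        using q[OF x] that x cong[of "q x" 0] by (simp add: f_def)
      show "f (r \<odot>\<^bsub>F 0\<^esub> x) = r \<odot>\<^bsub>M\<^esub> f x" for r
      proof -
        have "residue_class m (q (r \<odot>\<^bsub>F 0\<^esub> x)) = residue_class m (r * q x)"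
          using q[OF x] q[OF F0_closed(2)[OF x x]] x by (simp add: eps_scale Ns)
        from cong[OF this] show ?thesis using x F0_closed by (simp add: f_def Ms mult.assoc)
      qed
      fix y assume y: "y \<in> F0"
      show "f (x \<oplus>\<^bsub>F 0\<^esub> y) = f x \<oplus>\<^bsub>M\<^esub> f y"
      proof -
        have "residue_class m (q (x \<oplus>\<^bsub>F 0\<^esub> y)) = residue_class m (q x + q y)"
          using q[OF x] q[OF y] q[OF F0_closed(1)[OF x y]] x y by (simp add: eps_add Ns)
        from cong[OF this] show ?thesis using x y F0_closed by (simp add: f_def Ms distrib_right)
      qed
    qed (simp add: f_def)
    moreover have "f u = residue_class L p" using cong[of "q u" 1] q[OF u(1)] u by (simp add: f_def)
    then have "coords T (f u) = g" using g by (auto simp: coords lookup_p)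
    ultimately show ?thesis by blast
  qed
  have "vectorspace.dim ring_of_type_algebra V = card T"
  proof (rule dim_from_coordinates[of T \<Phi>])
    show "finite T" using assms(4) by (simp add: T_def)
    show "inj_on \<Phi> (carrier V)" using inj by (auto simp: inj_on_def Vs \<Phi>_def)
    show "\<Phi> ` carrier V = {g. \<forall>t. t \<notin> T \<longrightarrow> g t = 0}"
    proof
      show "\<Phi> ` carrier V \<subseteq> {g. \<forall>t. t \<notin> T \<longrightarrow> g t = 0}" by (auto simp: \<Phi>_def coords_def)
      show "{g. \<forall>t. t \<notin> T \<longrightarrow> g t = 0} \<subseteq> \<Phi> ` carrier V"
      proof
        fix g assume "g \<in> {g. \<forall>t. t \<notin> T \<longrightarrow> g t = (0 :: 'k)}"
        then obtain f where "f \<in> Z" "coords T (f u) = g" using surj[of g] by blast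
        then show "g \<in> \<Phi> ` carrier V" by (auto simp: Vs \<Phi>_def image_iff)
      qed
    qed
    show "\<zero>\<^bsub>V\<^esub> \<in> carrier V" using zero_in by (simp add: Vs Ms)
    show "\<Phi> \<zero>\<^bsub>V\<^esub> = (\<lambda>t. 0)" using u(1) coords[of 0] by (auto simp: Vs Ms \<Phi>_def fun_eq_iff)
  next
    fix x y assume "x \<in> carrier V" "y \<in> carrier V"
    then obtain f g where fg: "x = {f}" "f \<in> Z" "y = {g}" "g \<in> Z" unfolding Vs(1) by blast
    obtain p where p: "f u = residue_class L p" using at_u[OF fg(2)] by blast
    obtain q where q: "g u = residue_class L q" using at_u[OF fg(4)] by blast
    show "x \<oplus>\<^bsub>V\<^esub> y \<in> carrier V" using fg add_in by (simp add: Vs)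
    show "\<Phi> (x \<oplus>\<^bsub>V\<^esub> y) = (\<lambda>t. \<Phi> x t + \<Phi> y t)"
      using fg u(1) p q by (auto simp: Vs(3) \<Phi>_def Ms coords lookup_add)
  next
    fix c x assume "x \<in> carrier V"
    then obtain f where f: "x = {f}" "f \<in> Z" unfolding Vs(1) by blast
    obtain p where p: "f u = residue_class L p" using at_u[OF f(2)] by blast
    show "c \<odot>\<^bsub>V\<^esub> x \<in> carrier V" using f scale_in by (simp add: Vs)
    show "\<Phi> (c \<odot>\<^bsub>V\<^esub> x) = (\<lambda>t. c * \<Phi> x t)"
      using f u(1) p by (auto simp: Vs(4) \<Phi>_def Ms coords)
  qed
  then show ?thesis by (simp add: V_def M_def T_def)
qed

text \<open>
  The resolution hidden in \<open>ext_module\<close> is some resolution, since one exists, and the dimension of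
  \<open>Ext\<^sup>0\<close> is the same for all of them.
\<close>

lemma cm_type_eq_card_socle:
  fixes E :: "('n::finite \<Rightarrow>\<^sub>0 nat) set"
  assumes "upset E" "pure_powers E"
  shows "cm_type (quot_by_ideal (monomial_span E :: ('n, 'k::field) mpol set)) = card (socle E)"
proof -
  define m where "m = (monomial_span {a. a \<noteq> 0} :: ('n, 'k) mpol set)"
  have "ideal m mpol_ring" unfolding m_def maximal_ideal_eq[symmetric] by (rule genideal_is_ideal)
  from free_resolution_exists[OF this]
  have "\<exists>r. case r of (F :: nat \<Rightarrow> (('n, 'k) mpol, nat \<Rightarrow>\<^sub>0 ('n, 'k) mpol) module, d, \<epsilon>) \<Rightarrow>
      free_resolution mpol_ring (quot_by_ideal m) F d \<epsilon>"
    by (simp add: split_paired_Ex)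
  from someI_ex[OF this] obtain F :: "nat \<Rightarrow> (('n, 'k) mpol, nat \<Rightarrow>\<^sub>0 ('n, 'k) mpol) module" and d \<epsilon>
    where r: "(SOME (F, d, \<epsilon>). free_resolution mpol_ring (quot_by_ideal m) F d \<epsilon>) = (F, d, \<epsilon>)"
      "free_resolution mpol_ring (quot_by_ideal m) F d \<epsilon>"
    by (cases "SOME (F :: nat \<Rightarrow> (('n, 'k) mpol, nat \<Rightarrow>\<^sub>0 ('n, 'k) mpol) module, d, \<epsilon>).
        free_resolution mpol_ring (quot_by_ideal m) F d \<epsilon>") auto
  have dim: "the_enat (module_krull_dim mpol_ring (quot_by_ideal (monomial_span E :: ('n, 'k) mpol set))) = 0"
    by (simp add: krull_dim_eq_0[OF assms] zero_enat_def)
  show ?thesis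
    unfolding cm_type_def dim ext_module_def maximal_ideal_eq m_def[symmetric] r(1) prod.case
    unfolding m_def
    by (rule dim_Ext_0[OF assms(1) finite_socle[OF finite_Compl_upset[OF assms]] r(2)[unfolded m_def]])
qed

section \<open>The type of a product of monomial ideals\<close>

text \<open>
  If no exponent is smaller than both least pure powers, these two powers generate the ideal.
\<close>

lemma min_gens_two_axes:
  fixes E :: "('n::finite \<Rightarrow>\<^sub>0 nat) set"
  assumes "upset E" "pure_powers E" "UNIV = {i, j}"
    and "\<And>s. s \<in> E \<Longrightarrow> least_power E i \<le> lookup s i \<or> least_power E j \<le> lookup s j"
  shows "min_gens (monomial_span E :: ('n, 'k::field) mpol set) \<le> 2"
proof -
  define G where "G = {single i (least_power E i), single j (least_power E j)}"
  have "upset_of G = E"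
  proof
    have "G \<subseteq> E" using single_least_power[OF assms(2)] by (auto simp: G_def)
    then show "upset_of G \<subseteq> E" using assms(1) by (auto simp: upset_of_def sumset_def upset_def)
    show "E \<subseteq> upset_of G"
    proof
      fix s assume "s \<in> E"
      then obtain k where k: "k = i \<or> k = j" "least_power E k \<le> lookup s k" using assms(4) by blast
      then have "single k (least_power E k) \<in> upset_of G" using subset_upset_of[of G] by (auto simp: G_def)
      then show "s \<in> upset_of G"
        by (rule upset_mono[OF upset_upset_of]) (use k(2) in \<open>auto simp: lookup_single when_def\<close>)
    qed
  qed
  then have "(monomial_span E :: ('n, 'k) mpol set) = genideal mpol_ring (monomial ` G)"
    by (simp add: genideal_monomials)
  then have "min_gens (monomial_span E :: ('n, 'k) mpol set) \<le> card (monomial ` G :: ('n, 'k) mpol set)"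
    unfolding min_gens_def by (intro Least_le exI[of _ "monomial ` G"]) (simp add: G_def)
  also have "\<dots> \<le> card G" by (rule card_image_le) (simp add: G_def)
  also have "\<dots> \<le> 2" by (simp add: G_def card_insert_if)
  finally show ?thesis .
qed

theorem theorem5p1:
  fixes I J :: "('n::finite, 'k::field) mpol set"
  assumes "CARD('n) \<ge> 2"
    and "monomial_ideal I" and "monomial_ideal J"
    and "ideal_height mpol_ring I = enat CARD('n)"
    and "ideal_height mpol_ring J = enat CARD('n)"
    and "CARD('n) \<ge> 3 \<or> (CARD('n) = 2 \<and> max (min_gens I) (min_gens J) \<ge> 3)"
  shows "cm_type (quot_by_ideal (ideal_prod mpol_ring I J)) \<ge> 3"
proof -
  obtain A where A: "upset A" "I = monomial_span A" using monomial_idealE[OF assms(2)] by blast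
  obtain B where B: "upset B" "J = monomial_span B" using monomial_idealE[OF assms(3)] by blast
  have pA: "pure_powers A" "0 \<notin> A"
    using monomial_ideal_full_height[OF A(1)] assms(4) unfolding A(2) by blast+
  have pB: "pure_powers B" "0 \<notin> B"
    using monomial_ideal_full_height[OF B(1)] assms(5) unfolding B(2) by blast+
  have "3 \<le> card (socle (sumset A B))"
  proof (cases "3 \<le> CARD('n)")
    case True
    then show ?thesis using socle_sumset_three_variables[OF A(1) pA(1) pB(1) pA(2) pB(2)] by blast
  next
    case False
    then have two: "CARD('n) = 2" "3 \<le> max (min_gens I) (min_gens J)" using assms(6) by auto
    then obtain i j :: 'n where ij: "UNIV = {i, j}" "i \<noteq> j" unfolding card_2_iff by blast
    have interior: "\<exists>x\<in>E. lookup x i < least_power E i \<and> lookup x j < least_power E j"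
      if "upset E" "pure_powers E" "3 \<le> min_gens (monomial_span E :: ('n, 'k) mpol set)" for E
      using min_gens_two_axes[OF that(1,2) ij(1), where 'k = 'k] that(3) by (force simp: not_le)
    from two(2) have "3 \<le> min_gens I \<or> 3 \<le> min_gens J" by (simp add: le_max_iff_disj)
    then show ?thesis
    proof
      assume "3 \<le> min_gens I"
      then obtain x where "x \<in> A" "lookup x i < least_power A i" "lookup x j < least_power A j"
        using interior[OF A(1) pA(1)] A(2) by blast
      then show ?thesis
        by (rule socle_sumset_two_variables[OF A(1) pA(1) B(1) pB(1) pA(2) pB(2) ij])
    next
      assume "3 \<le> min_gens J"
      then obtain x where "x \<in> B" "lookup x i < least_power B i" "lookup x j < least_power B j"
        using interior[OF B(1) pB(1)] B(2) by blast
      then show ?thesis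
        unfolding sumset_commute[of A]
        by (rule socle_sumset_two_variables[OF B(1) pB(1) A(1) pA(1) pB(2) pA(2) ij])
    qed
  qed
  also have "card (socle (sumset A B)) = cm_type (quot_by_ideal (ideal_prod mpol_ring I J))"
    unfolding A(2) B(2) ideal_prod_monomial_span[OF A(1) B(1)]
    by (rule cm_type_eq_card_socle[OF upset_sumset[OF A(1)] pure_powers_sumset[OF pA(1) pB(1)], symmetric])
  finally show ?thesis .
qed

end
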